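(* Let $G=(V,D)$ be a directed graph and let $A,B\subseteq V$ be subsets of the same cardinality $k$, both with fixed linear orderings. Let $\mathbf{T}$ be a self-avoiding trek flow from $A$ to $B$ in $G$. Then the number of self-avoiding trek flows $\mathbf{T}'$ from $A$ to $B$ with $m_{\mathbf{T}'}=m_{\mathbf{T}}$ equals $2^{|\mathrm{UD}(\mathbf{T})|}$.
   Context: $G=(V,D)$ is a finite directed graph (possibly with directed cycles) without loops or multiple edges; edges $i\to j$ carry indeterminates $\lambda_{ij}$ and vertices $i$ indeterminates $\omega_{ii}$. A self-avoiding path visits each vertex at most once (empty paths at a vertex allowed); a self-avoiding cycle is a nonempty directed cycle visiting each vertex at most once, identified with its edge set. For $k$-subsets $X,Y$, a self-avoiding flow from $X$ to $Y$ is a pair $(\mathbf{P},\mathbf{C})$ where $\mathbf{P}$ is a set of $k$ self-avoiding pairwise vertex-disjoint paths whose initial vertices exhaust $X$ and final vertices exhaust $Y$, and $\mathbf{C}$ is a set of self-avoiding cycles, pairwise vertex-disjoint and vertex-disjoint from all paths in $\mathbf{P}$. A self-avoiding trek flow from $A$ to $B$ is a pair $\mathbf{T}=(\mathbf{F}_L,\mathbf{F}_R)$ where, for some $k$-subset $S\subseteq V$, $\mathbf{F}_L$ is a self-avoiding flow from $S$ to $A$ and $\mathbf{F}_R$ one from $S$ to $B$. Its monomial $m_{\mathbf{T}}$ is the product of $\omega_{ii}$ over $i\in S$ and of $\lambda_{ij}$ over all edges used by paths and cycles of $\mathbf{F}_L$ and of $\mathbf{F}_R$, with multiplicity. A vertex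 is visited by a flow if it lies on one of its paths (including empty paths) or cycles. Up-down cycles: let $E$ be the set of edges used by $\mathbf{F}_L$ or by $\mathbf{F}_R$ but not by both. Define a digraph $\Gamma$ on vertex set $E$: an edge $e=x\to y\in E$ used by $\mathbf{F}_L$ has an arrow to $f$ if either $y$ is visited by $\mathbf{F}_R$ and $f=z\to y$ is an edge of $\mathbf{F}_R$ entering $y$, or $y$ is not visited by $\mathbf{F}_R$ and $f=y\to z$ is an edge of $\mathbf{F}_L$ leaving $y$; otherwise $e$ has no outgoing arrow. An edge $e=x\to y\in E$ used by $\mathbf{F}_R$ has an arrow to $f$ if either $x$ is visited by $\mathbf{F}_L$ and $f=x\to z$ is an edge of $\mathbf{F}_L$ leaving $x$, or $x$ is not visited by $\mathbf{F}_L$ and $f=z\to x$ is an edge of $\mathbf{F}_R$ entering $x$; otherwise no outgoing arrow. An up-down cycle of $\mathbf{T}$ is the edge set supporting a nonempty directed cycle of $\Gamma$; $\mathrm{UD}(\mathbf{T})$ denotes the set of up-down cycles. *)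

theory Defs
  imports "HOL-Library.Poly_Mapping" "Graph_Theory.Graph_Theory"
begin

section \<open>Self-avoiding flows\<close>

text \<open>A path is given by its nonempty list of vertices, so that \<open>[v]\<close> is the empty path
  at \<open>v\<close>. A cycle is given by its set of edges.\<close>

definition self_avoiding_cycle :: "'v pair_pre_digraph \<Rightarrow> ('v \<times> 'v) set \<Rightarrow> bool" where
  "self_avoiding_cycle G c \<longleftrightarrow> (\<exists>p. pre_digraph.cycle (with_proj G) p \<and> c = set p)"

definition cycle_verts :: "('v \<times> 'v) set \<Rightarrow> 'v set" where
  "cycle_verts c = fst ` c \<union> snd ` c"

type_synonym 'v flow = "'v list set \<times> ('v \<times> 'v) set set"

abbreviation flow_paths :: "'v flow \<Rightarrow> 'v list set" where
  "flow_paths F \<equiv> fst F"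

abbreviation flow_cycles :: "'v flow \<Rightarrow> ('v \<times> 'v) set set" where
  "flow_cycles F \<equiv> snd F"

definition self_avoiding_flow ::
    "'v pair_pre_digraph \<Rightarrow> nat \<Rightarrow> 'v set \<Rightarrow> 'v set \<Rightarrow> 'v flow \<Rightarrow> bool" where
  "self_avoiding_flow G k X Y F \<longleftrightarrow>
     X \<subseteq> pverts G \<and> card X = k \<and> Y \<subseteq> pverts G \<and> card Y = k \<and>
     finite (flow_paths F) \<and> card (flow_paths F) = k \<and>
     (\<forall>p \<in> flow_paths F. vpath p (with_proj G)) \<and>
     pairwise (\<lambda>p q. disjnt (set p) (set q)) (flow_paths F) \<and>
     hd ` flow_paths F = X \<and> last ` flow_paths F = Y \<and>
     (\<forall>c \<in> flow_cycles F. self_avoiding_cycle G c) \<and>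
     pairwise (\<lambda>c d. disjnt (cycle_verts c) (cycle_verts d)) (flow_cycles F) \<and>
     (\<forall>p \<in> flow_paths F. \<forall>c \<in> flow_cycles F. disjnt (set p) (cycle_verts c))"

definition flow_edges :: "'v flow \<Rightarrow> ('v \<times> 'v) set" where
  "flow_edges F = (\<Union>p \<in> flow_paths F. set (vwalk_arcs p)) \<union> \<Union> (flow_cycles F)"

definition flow_verts :: "'v flow \<Rightarrow> 'v set" where
  "flow_verts F = (\<Union>p \<in> flow_paths F. set p) \<union> (\<Union>c \<in> flow_cycles F. cycle_verts c)"

section \<open>Self-avoiding trek flows and their monomials\<close>

text \<open>The first component is the flow to \<open>A\<close>, the second one the flow to \<open>B\<close>.\<close>

type_synonym 'v trek_flow = "'v flow \<times> 'v flow"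

definition self_avoiding_trek_flow ::
    "'v pair_pre_digraph \<Rightarrow> nat \<Rightarrow> 'v set \<Rightarrow> 'v set \<Rightarrow> 'v trek_flow \<Rightarrow> bool" where
  "self_avoiding_trek_flow G k A B T \<longleftrightarrow>
     (\<exists>S. self_avoiding_flow G k S A (fst T) \<and> self_avoiding_flow G k S B (snd T))"

text \<open>For a trek flow this is the set \<open>S\<close> of common initial vertices of the paths of the two
  flows.\<close>

definition trek_sources :: "'v trek_flow \<Rightarrow> 'v set" where
  "trek_sources T = hd ` flow_paths (fst T)"

text \<open>\<open>Omega i\<close> and \<open>Lambda i j\<close> name the indeterminates \<open>\<omega>\<^sub>i\<^sub>i\<close> and \<open>\<lambda>\<^sub>i\<^sub>j\<close>. Monomials are
  elements of the polynomial ring over the integers in these indeterminates.\<close>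

datatype 'v param = Omega 'v | Lambda 'v 'v

type_synonym 'v param_poly = "('v param \<Rightarrow>\<^sub>0 nat) \<Rightarrow>\<^sub>0 int"

definition indeterminate :: "'v param \<Rightarrow> 'v param_poly" where
  "indeterminate x = Poly_Mapping.single (Poly_Mapping.single x 1) 1"

abbreviation omega :: "'v \<Rightarrow> 'v param_poly" where
  "omega i \<equiv> indeterminate (Omega i)"

abbreviation lam :: "'v \<times> 'v \<Rightarrow> 'v param_poly" where
  "lam e \<equiv> indeterminate (Lambda (fst e) (snd e))"

definition flow_monomial :: "'v flow \<Rightarrow> 'v param_poly" where
  "flow_monomial F =
     (\<Prod>p \<in> flow_paths F. \<Prod>e\<leftarrow>vwalk_arcs p. lam e) * (\<Prod>c \<in> flow_cycles F. \<Prod>e \<in> c. lam e)"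

definition trek_monomial :: "'v trek_flow \<Rightarrow> 'v param_poly" where
  "trek_monomial T =
     (\<Prod>i \<in> trek_sources T. omega i) * flow_monomial (fst T) * flow_monomial (snd T)"

section \<open>Up-down cycles\<close>

definition unshared_edges :: "'v trek_flow \<Rightarrow> ('v \<times> 'v) set" where
  "unshared_edges T =
     (flow_edges (fst T) - flow_edges (snd T)) \<union> (flow_edges (snd T) - flow_edges (fst T))"

definition left_arrow :: "'v trek_flow \<Rightarrow> 'v \<times> 'v \<Rightarrow> 'v \<times> 'v \<Rightarrow> bool" where
  "left_arrow T e f \<longleftrightarrow>
     (if snd e \<in> flow_verts (snd T)
      then f \<in> flow_edges (snd T) \<and> snd f = snd e
      else f \<in> flow_edges (fst T) \<and> fst f = snd e)"

definition right_arrow :: "'v trek_flow \<Rightarrow> 'v \<times> 'v \<Rightarrow> 'v \<times> 'v \<Rightarrow> bool" where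
  "right_arrow T e f \<longleftrightarrow>
     (if fst e \<in> flow_verts (fst T)
      then f \<in> flow_edges (fst T) \<and> fst f = fst e
      else f \<in> flow_edges (snd T) \<and> snd f = fst e)"

definition up_down_digraph :: "'v trek_flow \<Rightarrow> ('v \<times> 'v) pair_pre_digraph" where
  "up_down_digraph T =
     \<lparr> pverts = unshared_edges T,
       parcs = {(e, f). e \<in> unshared_edges T \<and> f \<in> unshared_edges T \<and>
         (e \<in> flow_edges (fst T) \<and> left_arrow T e f \<or>
          e \<in> flow_edges (snd T) \<and> right_arrow T e f)} \<rparr>"

text \<open>A directed cycle of the digraph above is a list of its arcs; the edges of the original
  digraph supporting it are the vertices of this cycle.\<close>

definition up_down_cycles :: "'v trek_flow \<Rightarrow> ('v \<times> 'v) set set" where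
  "up_down_cycles T =
     {cycle_verts (set q) | q. pre_digraph.cycle (with_proj (up_down_digraph T)) q}"

end

theory Submission
  imports Defs
begin

text \<open>A self-avoiding flow from \<open>X\<close> to \<open>Y\<close> is the same thing as a set \<open>r\<close> of edges that is a partial
  injection with \<open>X \<inter> Range r = {}\<close>, \<open>Y \<inter> Domain r = {}\<close> and \<open>X \<union> Range r = Y \<union> Domain r\<close>; the last
  set consists of the visited vertices. The monomial of a trek flow with sources \<open>S\<close> and edge sets
  \<open>L\<close>, \<open>R\<close> determines exactly \<open>S\<close>, \<open>L \<inter> R\<close> and \<open>L \<union> R\<close>. Hence the trek flows with the same monomial
  correspond to the sets \<open>U\<close> of unshared edges for which exchanging \<open>U\<close> between \<open>L\<close> and \<open>R\<close> keeps both
  conditions. The digraph of up-down cycles is a partial injection on the unshared edges, and looking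
  at one vertex at a time shows that \<open>U\<close> is admissible iff each of its elements has both a successor
  and a predecessor in \<open>U\<close>. Such sets are
  the unions of the pairwise disjoint cycles.\<close>

section \<open>Partial injections and their cycles\<close>

definition partial_injection :: "'a rel \<Rightarrow> bool" where
  "partial_injection r \<longleftrightarrow> single_valued r \<and> single_valued (r\<inverse>)"

lemma partial_injection_succ_eq:
  "partial_injection r \<Longrightarrow> (x, y) \<in> r \<Longrightarrow> (x, z) \<in> r \<Longrightarrow> y = z"
  by (auto simp: partial_injection_def single_valued_def)

lemma partial_injection_pred_eq:
  "partial_injection r \<Longrightarrow> (x, z) \<in> r \<Longrightarrow> (y, z) \<in> r \<Longrightarrow> x = y"
  by (auto simp: partial_injection_def single_valued_def)

lemma partial_injection_subset: "partial_injection r \<Longrightarrow> s \<subseteq> r \<Longrightarrow> partial_injection s"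
  unfolding partial_injection_def single_valued_def by blast

lemma partial_injection_converse: "partial_injection (r\<inverse>) \<longleftrightarrow> partial_injection r"
  by (auto simp: partial_injection_def)

text \<open>Two pairs that share an entry in the same place have a common vertex in their fields, so
  disjointness puts them into the same member of \<open>K\<close>. This glues a flow from its paths
  and cycles.\<close>

lemma partial_injection_Union:
  assumes "\<And>r. r \<in> K \<Longrightarrow> partial_injection r"
    and "pairwise (\<lambda>r s. disjnt (Field r) (Field s)) K"
  shows "partial_injection (\<Union>K)"
proof -
  have eq: "r = s" if "r \<in> K" "s \<in> K" "v \<in> Field r" "v \<in> Field s" for r s v
    using that assms(2) by (auto simp: pairwise_def disjnt_iff)
  show ?thesis
    unfolding partial_injection_def single_valued_def
  proof (intro conjI allI impI)
    fix x y z assume "(x, y) \<in> \<Union>K" "(x, z) \<in> \<Union>K"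
    then obtain r s where "r \<in> K" "(x, y) \<in> r" "s \<in> K" "(x, z) \<in> s" by blast
    with eq[of r s x] show "y = z"
      by (metis FieldI1 assms(1) partial_injection_succ_eq)
  next
    fix x y z assume "(x, y) \<in> (\<Union>K)\<inverse>" "(x, z) \<in> (\<Union>K)\<inverse>"
    then obtain r s where "r \<in> K" "(y, x) \<in> r" "s \<in> K" "(z, x) \<in> s" by blast
    with eq[of r s x] show "y = z"
      by (metis FieldI2 assms(1) partial_injection_pred_eq)
  qed
qed

text \<open>The edge set of a directed cycle, described without a list or a starting vertex: a
  bijection of a finite nonempty set with a single orbit.\<close>

definition circular :: "'a rel \<Rightarrow> bool" where
  "circular c \<longleftrightarrow> finite c \<and> c \<noteq> {} \<and> partial_injection c \<and> Domain c = Range c \<and>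
     (\<forall>x \<in> Domain c. \<forall>y \<in> Domain c. (x, y) \<in> c\<^sup>+)"

text \<open>Only forward reachability enters; when \<open>x\<close> lies on a cycle of a partial
  injection, this is that cycle.\<close>

definition component :: "'a rel \<Rightarrow> 'a \<Rightarrow> 'a rel" where
  "component r x = r \<inter> (r\<^sup>* `` {x}) \<times> UNIV"

lemma cycle_verts_eq_Field: "cycle_verts c = Field c"
  by (force simp: cycle_verts_def Field_def)

lemma Field_circular: "circular c \<Longrightarrow> Field c = Domain c"
  by (auto simp: circular_def Field_def)

text \<open>Every vertex of \<open>c\<close> has its only \<open>r\<close>-successor inside
  \<open>c\<close>, so a walk in \<open>r\<close> that starts on \<open>c\<close> cannot leave
  it.\<close>

lemma rtrancl_in_circular:
  assumes "partial_injection r" "circular c" "c \<subseteq> r" "(x, y) \<in> r\<^sup>*" "x \<in> Domain c"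
  shows "y \<in> Domain c"
  using assms(4,5)
proof (induction rule: rtrancl_induct)
  case (step y z)
  then obtain w where "(y, w) \<in> c" by auto
  with step assms(3) have "w = z" by (metis assms(1) partial_injection_succ_eq subsetD)
  with \<open>(y, w) \<in> c\<close> assms(2) show ?case by (auto simp: circular_def)
qed

lemma Domain_circular:
  assumes "partial_injection r" "circular c" "c \<subseteq> r" "x \<in> Domain c"
  shows "Domain c = r\<^sup>* `` {x}"
proof
  show "Domain c \<subseteq> r\<^sup>* `` {x}"
  proof
    fix y assume "y \<in> Domain c"
    with assms(2,4) have "(x, y) \<in> c\<^sup>+" by (auto simp: circular_def)
    with assms(3) have "(x, y) \<in> r\<^sup>+" by (rule trancl_mono[rotated])
    then show "y \<in> r\<^sup>* `` {x}" by auto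
  qed
  show "r\<^sup>* `` {x} \<subseteq> Domain c" using rtrancl_in_circular[OF assms(1-3)] assms(4) by auto
qed

text \<open>The right-hand side does not involve \<open>c\<close>, so a circular subrelation is
  determined by any one of its vertices, and distinct ones have disjoint domains.\<close>

lemma circular_eq_component:
  assumes "partial_injection r" "circular c" "c \<subseteq> r" "x \<in> Domain c"
  shows "c = component r x"
proof -
  have "r \<inter> Domain c \<times> UNIV \<subseteq> c"
  proof
    fix e assume "e \<in> r \<inter> Domain c \<times> UNIV"
    then obtain a b b' where "e = (a, b)" "(a, b) \<in> r" "(a, b') \<in> c" by auto
    with assms(3) partial_injection_succ_eq[OF assms(1), of a b b'] show "e \<in> c" by auto
  qed
  with assms(3) have "c = r \<inter> Domain c \<times> UNIV" by auto
  with Domain_circular[OF assms] show ?thesis by (simp add: component_def)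
qed

lemma circular_eq:
  assumes "partial_injection r" "circular c" "c \<subseteq> r" "circular d" "d \<subseteq> r"
    and "x \<in> Domain c" "x \<in> Domain d"
  shows "c = d"
  using assms circular_eq_component by metis

text \<open>Steps in \<open>r\<close> are forced: the step out of \<open>y\<close> is also the first
  step of the walk from \<open>y\<close> back to \<open>x\<close>, so the rest of that walk still
  leads to \<open>x\<close>.\<close>

lemma rtrancl_cycle_back:
  assumes "partial_injection r" "(x, y) \<in> r\<^sup>*" "(x, x) \<in> r\<^sup>+"
  shows "(y, x) \<in> r\<^sup>*"
  using assms(2)
proof (induction rule: rtrancl_induct)
  case (step y z)
  show ?case
  proof (cases "y = x")
    \<comment> \<open>Here the walk back is empty, and another turn around the given closed walk
      replaces it.\<close>
    case True
    from assms(3) obtain w where "(x, w) \<in> r" "(w, x) \<in> r\<^sup>*" by (auto dest: tranclD)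
    with True step show ?thesis by (metis assms(1) partial_injection_succ_eq)
  next
    case False
    with step obtain w where "(y, w) \<in> r" "(w, x) \<in> r\<^sup>*" by (auto elim: converse_rtranclE)
    with step show ?thesis by (metis assms(1) partial_injection_succ_eq)
  qed
qed simp

lemma circular_component:
  assumes "partial_injection r" "finite r" "(x, x) \<in> r\<^sup>+"
  shows "circular (component r x)" "x \<in> Domain (component r x)"
proof -
  let ?c = "component r x"
  have dom: "Domain ?c = r\<^sup>* `` {x}"
  proof
    show "r\<^sup>* `` {x} \<subseteq> Domain ?c"
    proof
      fix y assume y: "y \<in> r\<^sup>* `` {x}"
      with rtrancl_cycle_back[OF assms(1) _ assms(3)] assms(3)
      have "(y, y) \<in> r\<^sup>+" by (meson Image_singleton_iff rtrancl_trancl_trancl trancl_rtrancl_trancl)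
      then obtain z where "(y, z) \<in> r" by (auto dest: tranclD)
      with y show "y \<in> Domain ?c" by (auto simp: component_def)
    qed
  qed (auto simp: component_def)
  then show "x \<in> Domain ?c" by auto
  have reach: "(y, z) \<in> ?c\<^sup>*" if "(y, z) \<in> r\<^sup>*" "y \<in> r\<^sup>* `` {x}" for y z
    using that(1)
  proof (induction rule: rtrancl_induct)
    case (step z w)
    with that have "(z, w) \<in> ?c" by (auto simp: component_def)
    with step show ?case by auto
  qed simp
  have ran: "Range ?c = r\<^sup>* `` {x}"
  proof
    show "Range ?c \<subseteq> r\<^sup>* `` {x}" by (auto simp: component_def)
    show "r\<^sup>* `` {x} \<subseteq> Range ?c"
    proof
      fix y assume "y \<in> r\<^sup>* `` {x}"
      with assms(3) have "(x, y) \<in> r\<^sup>+" by auto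
      then obtain z where "(x, z) \<in> r\<^sup>*" "(z, y) \<in> r" by (auto dest: tranclD2)
      then show "y \<in> Range ?c" by (auto simp: component_def)
    qed
  qed
  show "circular ?c"
    unfolding circular_def
  proof (intro conjI ballI)
    show "finite ?c" "partial_injection ?c"
      using assms by (auto simp: component_def intro: partial_injection_subset)
    show "Domain ?c = Range ?c" using dom ran by simp
    then show "?c \<noteq> {}" using \<open>x \<in> Domain ?c\<close> by auto
    fix y z assume yz: "y \<in> Domain ?c" "z \<in> Domain ?c"
    then obtain w where w: "(y, w) \<in> ?c" by auto
    with ran have "w \<in> r\<^sup>* `` {x}" by auto
    moreover from this have "(w, x) \<in> r\<^sup>*" using rtrancl_cycle_back[OF assms(1) _ assms(3)] by auto
    with yz dom have "(w, z) \<in> r\<^sup>*" by (auto intro: rtrancl_trans)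
    ultimately show "(y, z) \<in> ?c\<^sup>+" using reach w by (meson rtrancl_into_trancl2)
  qed
qed

text \<open>By injectivity a closed walk through a point reachable from \<open>x\<close> can be
  pulled back to one through \<open>x\<close>. Hence nothing reachable from \<open>x\<close> is
  cyclic, and in the finite acyclic component some reachable point has no successor.\<close>

lemma reaches_terminal:
  assumes "partial_injection r" "finite r" "(x, x) \<notin> r\<^sup>+"
  obtains y where "(x, y) \<in> r\<^sup>*" "y \<notin> Domain r"
proof -
  define s where "s = component r x"
  have cyclic: "(x, x) \<in> r\<^sup>+" if "(x, y) \<in> r\<^sup>*" "(y, y) \<in> r\<^sup>+" for y
    using that
  proof (induction rule: rtrancl_induct)
    case (step y z)
    from step.prems obtain w where "(z, w) \<in> r\<^sup>*" "(w, z) \<in> r" by (auto dest: tranclD2)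
    with step.hyps have "(z, y) \<in> r\<^sup>*" by (metis assms(1) partial_injection_pred_eq)
    with step show ?case by (meson rtrancl_into_trancl2)
  qed simp
  have "acyclic s"
  proof (rule acyclicI, rule allI, rule notI)
    fix y assume "(y, y) \<in> s\<^sup>+"
    moreover then obtain z where "(y, z) \<in> s" by (auto dest: tranclD)
    moreover have "s \<subseteq> r" by (auto simp: s_def component_def)
    ultimately have "(x, y) \<in> r\<^sup>*" "(y, y) \<in> r\<^sup>+"
      by (auto simp: s_def component_def trancl_mono)
    with cyclic assms(3) show False by blast
  qed
  moreover have "finite s" using assms(2) by (simp add: s_def component_def)
  ultimately have "wf (s\<inverse>)" by (rule finite_acyclic_wf_converse[rotated])
  then obtain y where y: "y \<in> r\<^sup>* `` {x}" "\<And>z. (z, y) \<in> s\<inverse> \<Longrightarrow> z \<notin> r\<^sup>* `` {x}"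
    by (rule wfE_min[where Q = "r\<^sup>* `` {x}" and x = x]) auto
  have "y \<notin> Domain r"
  proof
    assume "y \<in> Domain r"
    then obtain z where z: "(y, z) \<in> r" by auto
    with y(1) have "(y, z) \<in> s" "(x, z) \<in> r\<^sup>*" by (auto simp: s_def component_def)
    with y(2) show False by auto
  qed
  with y(1) that show ?thesis by auto
qed

lemma reaches_initial:
  assumes "partial_injection r" "finite r" "(x, x) \<notin> r\<^sup>+"
  obtains y where "(y, x) \<in> r\<^sup>*" "y \<notin> Range r"
proof -
  have "partial_injection (r\<inverse>)" "finite (r\<inverse>)" "(x, x) \<notin> (r\<inverse>)\<^sup>+"
    using assms by (simp_all add: partial_injection_converse trancl_converse)
  then obtain y where "(x, y) \<in> (r\<inverse>)\<^sup>*" "y \<notin> Domain (r\<inverse>)" by (rule reaches_terminal)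
  with that show ?thesis by (auto simp: rtrancl_converse)
qed

section \<open>Closed walks of a digraph and circular relations\<close>

lemma pcas_fst_snd: "pcas u p v \<Longrightarrow> map fst p @ [v] = u # map snd p"
  by (induction p arbitrary: u) auto

lemma pcas_rtrancl: "pcas u p v \<Longrightarrow> set p \<subseteq> c \<Longrightarrow> (u, v) \<in> c\<^sup>*"
  by (induction p arbitrary: u) (auto intro: converse_rtrancl_into_rtrancl)

lemma tl_pawalk_verts: "pcas u p v \<Longrightarrow> tl (pawalk_verts u p) = map snd p"
proof (induction p arbitrary: u)
  case (Cons e es)
  then show ?case by (cases es) auto
qed simp

lemma circular_set_closed_walk:
  assumes "pcas u p u" "distinct (tl (pawalk_verts u p))" "p \<noteq> []"
  shows "circular (set p)"
proof -
  note conv = pcas_fst_snd[OF assms(1)]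
  have dsnd: "distinct (map snd p)" using assms(2) by (simp only: tl_pawalk_verts[OF assms(1)])
  \<comment> \<open>For a closed walk \<open>u\<close> stands on both sides of \<open>conv\<close>;
    cancelling it shows that tails and heads agree as multisets, so distinctness of the heads passes
    to the tails.\<close>
  have "mset (map fst p) = mset (map snd p)"
    using arg_cong[OF conv, of mset] by simp
  then have dfst: "distinct (map fst p)" and img: "fst ` set p = snd ` set p"
    using dsnd by (metis distinct_map mset_eq_imp_distinct_iff, metis list.set_map mset_eq_setD)
  have pi: "partial_injection (set p)"
    using dfst dsnd unfolding partial_injection_def single_valued_def distinct_map inj_on_def
    by force
  have dr: "Domain (set p) = Range (set p)" using img by (simp add: Domain_fst Range_snd)
  have walks: "(u, x) \<in> (set p)\<^sup>* \<and> (x, u) \<in> (set p)\<^sup>+" if "x \<in> Domain (set p)" for x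
  proof -
    from that obtain y where "(x, y) \<in> set p" by auto
    then obtain p1 p2 where p: "p = p1 @ (x, y) # p2" by (auto simp: in_set_conv_decomp)
    have app: "pcas u (q1 @ (x, y) # q2) v \<Longrightarrow> pcas u q1 x \<and> pcas y q2 v" for u q1 q2 v
      by (induction q1 arbitrary: u) auto
    have "pcas u p1 x" "pcas y p2 u" using app assms(1) p by blast+
    then have "(u, x) \<in> (set p)\<^sup>*" "(y, u) \<in> (set p)\<^sup>*"
      using p by (auto intro: pcas_rtrancl)
    with \<open>(x, y) \<in> set p\<close> show ?thesis by (meson rtrancl_into_trancl2)
  qed
  then have "(x, y) \<in> (set p)\<^sup>+" if "x \<in> Domain (set p)" "y \<in> Domain (set p)" for x y
    using that by (meson trancl_rtrancl_trancl)
  with pi dr assms(3) show ?thesis by (auto simp: circular_def)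
qed

text \<open>No list is built from \<open>c\<close> directly. The digraph with edge set
  \<open>c\<close> has a closed walk, hence a cycle, and the edge set of that cycle is a circular
  part of \<open>c\<close> sharing a vertex with it, so it is all of \<open>c\<close>.\<close>

lemma circular_imp_cycle:
  assumes "circular c" "c \<subseteq> parcs H" "Domain c \<subseteq> pverts H"
  obtains p where "pre_digraph.cycle (with_proj H) p" "c = set p"
proof -
  define K where "K = \<lparr>pverts = Domain c, parcs = c\<rparr>"
  have "Domain c = Range c" using assms(1) by (simp add: circular_def)
  then have "pair_wf_digraph K"
    by unfold_locales (force simp: K_def)+
  then interpret pair_wf_digraph K .
  from assms(1) obtain x where x: "x \<in> Domain c" by (auto simp: circular_def)
  with assms(1) have "(x, x) \<in> c\<^sup>+" by (simp add: circular_def)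
  then have "(x, x) \<in> (parcs K)\<^sup>+" by (simp add: K_def)
  then obtain w where "awalk x w x" "w \<noteq> []"
    using reachable1_awalk[of x x] by auto
  then have "closed_w w" by (auto simp: closed_w_def)
  then obtain p where "cycle p" using closed_w_imp_cycle by blast
  then obtain u where p: "u \<in> Domain c" "set p \<subseteq> c" "pcas u p u"
      "distinct (tl (pawalk_verts u p))" "p \<noteq> []"
    unfolding cycle_def awalk_def by (auto simp: K_def awalk_verts_with_proj_eq cas_with_proj_eq)
  then have "circular (set p)" by (intro circular_set_closed_walk)
  moreover have "u \<in> Domain (set p)"
    using p(3,5) by (cases p) auto
  ultimately have "c = set p"
    using assms(1) p(1,2) circular_eq[of c c "set p" u] by (auto simp: circular_def)
  moreover have "pre_digraph.cycle (with_proj H) p"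
    unfolding pre_digraph.cycle_def pre_digraph.awalk_def cas_with_proj_eq awalk_verts_with_proj_eq
    using p assms(2) subsetD[OF assms(3) p(1)] by auto
  ultimately show ?thesis using that by blast
qed

text \<open>Stated for an arbitrary \<open>H\<close> because it serves both the cycles of
  \<open>G\<close> and the cycles of the up-down digraph.\<close>

lemma cycle_iff_circular:
  assumes "pair_wf_digraph H"
  shows "(\<exists>p. pre_digraph.cycle (with_proj H) p \<and> c = set p) \<longleftrightarrow> c \<subseteq> parcs H \<and> circular c"
proof
  assume "\<exists>p. pre_digraph.cycle (with_proj H) p \<and> c = set p"
  then show "c \<subseteq> parcs H \<and> circular c"
    unfolding pre_digraph.cycle_def pre_digraph.awalk_def cas_with_proj_eq awalk_verts_with_proj_eq
    by (auto intro: circular_set_closed_walk)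
next
  assume "c \<subseteq> parcs H \<and> circular c"
  moreover then have "Domain c \<subseteq> pverts H"
    using pair_wf_digraph.in_arcsD1[OF assms] by blast
  ultimately show "\<exists>p. pre_digraph.cycle (with_proj H) p \<and> c = set p"
    by (metis circular_imp_cycle)
qed

lemma self_avoiding_cycle_iff_circular:
  "pair_wf_digraph G \<Longrightarrow> self_avoiding_cycle G c \<longleftrightarrow> c \<subseteq> parcs G \<and> circular c"
  by (simp add: self_avoiding_cycle_def cycle_iff_circular)

section \<open>Invariant sets as unions of cycles\<close>

definition invariant_set :: "'a rel \<Rightarrow> 'a set \<Rightarrow> bool" where
  "invariant_set r U \<longleftrightarrow> (\<forall>x \<in> U. (\<exists>y \<in> U. (x, y) \<in> r) \<and> (\<exists>y \<in> U. (y, x) \<in> r))"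

lemma invariant_set_rtrancl:
  assumes "partial_injection r" "invariant_set r U" "x \<in> U" "(x, y) \<in> r\<^sup>*"
  shows "y \<in> U"
  using assms(4,3)
proof (induction rule: rtrancl_induct)
  case (step y z)
  then obtain w where "w \<in> U" "(y, w) \<in> r" using assms(2) by (auto simp: invariant_set_def)
  with partial_injection_succ_eq[OF assms(1) step.hyps(2)] show ?case by simp
qed

text \<open>Taking unions is a bijection from the sets of cycle domains to the invariant sets. It is
  injective because the domains are nonempty and pairwise disjoint, and surjective because every
  point of an invariant set lies on a cycle that stays inside the set.\<close>

lemma card_invariant_sets:
  assumes "partial_injection r" "finite r"
  shows "card {U. invariant_set r U} = 2 ^ card {Domain c |c. c \<subseteq> r \<and> circular c}"
proof -
  define \<C> where "\<C> = {Domain c |c. c \<subseteq> r \<and> circular c}"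
  have "finite \<C>"
    by (rule finite_subset[of _ "Domain ` Pow r"]) (use assms(2) in \<open>auto simp: \<C>_def\<close>)
  have eq: "C = D" if "C \<in> \<C>" "D \<in> \<C>" "x \<in> C" "x \<in> D" for C D x
  proof -
    from that(1,2) obtain c d where "C = Domain c" "c \<subseteq> r" "circular c"
        "D = Domain d" "d \<subseteq> r" "circular d"
      by (auto simp: \<C>_def)
    with that(3,4) circular_eq[OF assms(1), of c d x] show ?thesis by simp
  qed
  have ne: "C \<noteq> {}" if "C \<in> \<C>" for C
    using that by (auto simp: \<C>_def circular_def)
  \<comment> \<open>A domain covered by \<open>\<Union>K\<close> shares a point with some member of
    \<open>K\<close>, and then equals it; thus \<open>K\<close> can be read off from its
    union.\<close>
  have mem: "C \<in> K \<longleftrightarrow> C \<subseteq> \<Union>K" if "K \<subseteq> \<C>" "C \<in> \<C>" for C K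
  proof
    assume "C \<subseteq> \<Union>K"
    moreover from that ne obtain x where "x \<in> C" by blast
    ultimately obtain D where "D \<in> K" "x \<in> D" by blast
    with eq[of C D x] that(2) subsetD[OF that(1)] \<open>x \<in> C\<close> show "C \<in> K" by simp
  qed auto
  have "inj_on Union (Pow \<C>)"
  proof (rule inj_onI)
    fix K L assume "K \<in> Pow \<C>" "L \<in> Pow \<C>" "\<Union>K = \<Union>L"
    then have "C \<in> K \<longleftrightarrow> C \<in> L" if "C \<in> \<C>" for C using that mem by simp
    with \<open>K \<in> Pow \<C>\<close> \<open>L \<in> Pow \<C>\<close> show "K = L" by blast
  qed
  moreover have "Union ` Pow \<C> = {U. invariant_set r U}"
  proof (intro equalityI subsetI)
    fix U assume "U \<in> Union ` Pow \<C>"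
    then obtain K where K: "K \<subseteq> \<C>" "U = \<Union>K" by auto
    have "\<exists>y \<in> U. (x, y) \<in> r" "\<exists>y \<in> U. (y, x) \<in> r" if "x \<in> U" for x
    proof -
      from that K obtain c where c: "Domain c \<in> K" "c \<subseteq> r" "circular c" "x \<in> Domain c"
        unfolding \<C>_def by blast
      then have "Domain c = Range c" by (simp add: circular_def)
      then obtain y z where "(x, y) \<in> c" "(z, x) \<in> c" "y \<in> Domain c" "z \<in> Domain c"
        using c(4) by blast
      with c K show "\<exists>y \<in> U. (x, y) \<in> r" "\<exists>y \<in> U. (y, x) \<in> r" by blast+
    qed
    then show "U \<in> {U. invariant_set r U}" by (simp add: invariant_set_def)
  next
    fix U assume "U \<in> {U. invariant_set r U}"
    then have U: "invariant_set r U" by simp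
    have "\<exists>C \<in> \<C>. x \<in> C \<and> C \<subseteq> U" if x: "x \<in> U" for x
    proof -
      \<comment> \<open>Otherwise the forward walk from \<open>x\<close> would end at a point
        without successor, although it never leaves \<open>U\<close>.\<close>
      have "(x, x) \<in> r\<^sup>+"
      proof (rule ccontr)
        assume "(x, x) \<notin> r\<^sup>+"
        with assms obtain y where "(x, y) \<in> r\<^sup>*" "y \<notin> Domain r" by (rule reaches_terminal)
        with invariant_set_rtrancl[OF assms(1) U x] U show False
          by (auto simp: invariant_set_def)
      qed
      note c = circular_component[OF assms this]
      have sub: "component r x \<subseteq> r" by (simp add: component_def)
      have "Domain (component r x) \<subseteq> U"
        using Domain_circular[OF assms(1) c(1) sub c(2)]
          invariant_set_rtrancl[OF assms(1) U x] by auto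
      moreover have "Domain (component r x) \<in> \<C>" using c(1) sub by (auto simp: \<C>_def)
      ultimately show ?thesis using c(2) by blast
    qed
    then have "U = \<Union>{C \<in> \<C>. C \<subseteq> U}" by blast
    moreover have "{C \<in> \<C>. C \<subseteq> U} \<in> Pow \<C>" by simp
    ultimately show "U \<in> Union ` Pow \<C>" by (rule image_eqI)
  qed
  ultimately have "card {U. invariant_set r U} = card (Pow \<C>)"
    by (metis card_image)
  with \<open>finite \<C>\<close> show ?thesis by (simp add: card_Pow \<C>_def)
qed

section \<open>Self-avoiding flows as edge sets\<close>

definition linkage :: "'v set \<Rightarrow> 'v set \<Rightarrow> 'v rel \<Rightarrow> bool" where
  "linkage X Y r \<longleftrightarrow> partial_injection r \<and> X \<inter> Range r = {} \<and> Y \<inter> Domain r = {} \<and>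
     X \<union> Range r = Y \<union> Domain r"

text \<open>Self-avoidance is not demanded here: for a linkage it follows, because a vertex of
  \<open>Y\<close> has no outgoing edge.\<close>

definition linkage_paths :: "'v set \<Rightarrow> 'v set \<Rightarrow> 'v rel \<Rightarrow> 'v list set" where
  "linkage_paths X Y r = {p. p \<noteq> [] \<and> hd p \<in> X \<and> last p \<in> Y \<and> set (vwalk_arcs p) \<subseteq> r}"

text \<open>The inverse of \<open>flow_edges\<close>: the flow is rebuilt from its edges as all
  walks from \<open>X\<close> to \<open>Y\<close> and all cycles inside \<open>r\<close>.\<close>

definition linkage_flow :: "'v set \<Rightarrow> 'v set \<Rightarrow> 'v rel \<Rightarrow> 'v flow" where
  "linkage_flow X Y r = (linkage_paths X Y r, {c. c \<subseteq> r \<and> circular c})"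

section \<open>Edge sets of vertex lists\<close>

lemma Domain_vwalk_arcs:
  "distinct p \<Longrightarrow> p \<noteq> [] \<Longrightarrow> Domain (set (vwalk_arcs p)) = set p - {last p}"
  by (induction p rule: vwalk_arcs.induct) auto

lemma Range_vwalk_arcs:
  "distinct p \<Longrightarrow> p \<noteq> [] \<Longrightarrow> Range (set (vwalk_arcs p)) = set p - {hd p}"
  by (induction p rule: vwalk_arcs.induct) auto

lemma set_subset_vwalk_arcs: "p \<noteq> [] \<Longrightarrow> set p \<subseteq> insert (hd p) (Range (set (vwalk_arcs p)))"
  by (induction p rule: vwalk_arcs.induct) auto

lemma set_vwalk_arcs_subset: "set (vwalk_arcs p) \<subseteq> set p \<times> set p"
  by (induction p rule: vwalk_arcs.induct) auto

lemma partial_injection_vwalk_arcs: "distinct p \<Longrightarrow> partial_injection (set (vwalk_arcs p))"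
proof (induction p rule: vwalk_arcs.induct)
  case (3 x y xs)
  have "Range (set (vwalk_arcs (y # xs))) = set xs" "Domain (set (vwalk_arcs (y # xs))) \<subseteq> set (y # xs)"
    using 3(2) Range_vwalk_arcs[of "y # xs"] Domain_vwalk_arcs[of "y # xs"] by auto
  with 3(2) have "(x, z) \<notin> set (vwalk_arcs (y # xs))" "(z, y) \<notin> set (vwalk_arcs (y # xs))" for z
    by auto
  with 3 show ?case by (auto simp: partial_injection_def single_valued_def)
qed (auto simp: partial_injection_def)

lemma distinct_vwalk_arcs: "distinct p \<Longrightarrow> distinct (vwalk_arcs p)"
proof (induction p rule: vwalk_arcs.induct)
  case (3 x y xs)
  then show ?case using set_vwalk_arcs_subset[of "y # xs"] by auto
qed auto

lemma set_vwalk_arcs_rev: "set (vwalk_arcs (rev p)) = (set (vwalk_arcs p))\<inverse>"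
proof (induction p)
  case (Cons a p)
  then show ?case
    by (cases "p = []") (auto simp: set_vwalk_arcs_snoc last_rev)
qed simp

lemma vwalk_arcs_middle:
  "set (vwalk_arcs (p @ v # q)) = set (vwalk_arcs (p @ [v])) \<union> set (vwalk_arcs (v # q))"
proof (cases "p = []")
  case False
  then show ?thesis by (simp add: vwalk_arcs_append)
qed simp

lemma vwalk_rtrancl_last: "x \<in> set p \<Longrightarrow> (x, last p) \<in> (set (vwalk_arcs p))\<^sup>*"
proof (induction p arbitrary: x rule: vwalk_arcs.induct)
  case (3 a b xs x)
  let ?r = "set (vwalk_arcs (b # xs))"
  have mono: "?r\<^sup>* \<subseteq> (set (vwalk_arcs (a # b # xs)))\<^sup>*" by (intro rtrancl_mono) auto
  have "(b, last (b # xs)) \<in> ?r\<^sup>*" by (rule "3.IH") simp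
  with mono have "(b, last (b # xs)) \<in> (set (vwalk_arcs (a # b # xs)))\<^sup>*" by blast
  moreover have "(a, b) \<in> set (vwalk_arcs (a # b # xs))" by simp
  ultimately have "(a, last (b # xs)) \<in> (set (vwalk_arcs (a # b # xs)))\<^sup>*"
    by (meson converse_rtrancl_into_rtrancl)
  moreover have "(x, last (b # xs)) \<in> (set (vwalk_arcs (a # b # xs)))\<^sup>*" if "x \<in> set (b # xs)" for x
    using "3.IH"[OF that] mono by blast
  ultimately show ?case using "3.prems" by (auto simp del: vwalk_arcs.simps)
qed auto

section \<open>Paths and cycles inside an edge set\<close>

lemma rtrancl_imp_vwalk:
  assumes "(x, y) \<in> r\<^sup>*"
  obtains p where "p \<noteq> []" "hd p = x" "last p = y" "set (vwalk_arcs p) \<subseteq> r"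
  using assms
proof (induction arbitrary: thesis rule: converse_rtrancl_induct)
  case base
  show ?case by (rule base[of "[y]"]) auto
next
  case (step x z)
  from step.IH obtain p where "p \<noteq> []" "hd p = z" "last p = y" "set (vwalk_arcs p) \<subseteq> r" .
  with step.hyps show ?case by (intro step.prems[of "x # p"]) auto
qed

text \<open>Each next vertex is forced, and neither walk can stop while the other goes on, since the
  last vertices have no successor.\<close>

lemma terminal_vwalk_unique:
  assumes "partial_injection r" "p \<noteq> []" "q \<noteq> []" "hd p = hd q"
    and "set (vwalk_arcs p) \<subseteq> r" "set (vwalk_arcs q) \<subseteq> r" "last p \<notin> Domain r" "last q \<notin> Domain r"
  shows "p = q"
  using assms(2-)
proof (induction p arbitrary: q)
  case (Cons a p)
  then obtain q' where q: "q = a # q'" by (cases q) auto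
  show ?case
  proof (cases "p = [] \<or> q' = []")
    case True
    with Cons.prems q show ?thesis
      by (cases "p = []"; cases "q' = []") (auto simp: Domain_iff)
  next
    case False
    with Cons.prems q have "(a, hd p) \<in> r" "(a, hd q') \<in> r" by auto
    with partial_injection_succ_eq[OF assms(1)] have "hd p = hd q'" by blast
    with Cons False q show ?thesis by auto
  qed
qed simp

lemma initial_vwalk_unique:
  assumes "partial_injection r" "p \<noteq> []" "q \<noteq> []" "last p = last q"
    and "set (vwalk_arcs p) \<subseteq> r" "set (vwalk_arcs q) \<subseteq> r" "hd p \<notin> Range r" "hd q \<notin> Range r"
  shows "p = q"
proof -
  have "rev p = rev q"
    by (rule terminal_vwalk_unique[of "r\<inverse>"])
      (use assms in \<open>auto simp: partial_injection_converse set_vwalk_arcs_rev hd_rev last_rev\<close>)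
  then show ?thesis by simp
qed

text \<open>Both paths are cut at \<open>v\<close>. The parts after \<open>v\<close> are walks from
  \<open>v\<close> to a vertex without successor, the parts before it are walks to \<open>v\<close>
  from a vertex without predecessor; both kinds are unique.\<close>

lemma linkage_paths_eq:
  assumes "linkage X Y r" "p \<in> linkage_paths X Y r" "q \<in> linkage_paths X Y r"
    and "v \<in> set p" "v \<in> set q"
  shows "p = q"
proof -
  from assms(4,5) obtain p1 p2 q1 q2 where pq: "p = p1 @ v # p2" "q = q1 @ v # q2"
    by (meson split_list)
  have pi: "partial_injection r" using assms(1) by (simp add: linkage_def)
  have ends: "hd s \<notin> Range r" "last s \<notin> Domain r" "set (vwalk_arcs s) \<subseteq> r"
    if "s \<in> linkage_paths X Y r" for s
    using that assms(1) by (auto simp: linkage_paths_def linkage_def)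
  note e = ends[OF assms(2)] ends[OF assms(3)]
  note arcs = vwalk_arcs_middle[of p1 v p2] vwalk_arcs_middle[of q1 v q2]
  have "v # p2 = v # q2"
    by (rule terminal_vwalk_unique[OF pi]) (use e arcs in \<open>auto simp: pq\<close>)
  moreover have "p1 @ [v] = q1 @ [v]"
    by (rule initial_vwalk_unique[OF pi])
      (use e arcs in \<open>auto simp: pq hd_append split: if_splits\<close>)
  ultimately show ?thesis using pq by simp
qed

text \<open>A repeated vertex would start two walks of different lengths to the end of
  \<open>p\<close>, against uniqueness.\<close>

lemma distinct_linkage_path:
  assumes "linkage X Y r" "p \<in> linkage_paths X Y r"
  shows "distinct p"
proof (rule ccontr)
  assume "\<not> distinct p"
  then obtain p1 p2 p3 v where p: "p = p1 @ [v] @ p2 @ [v] @ p3"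
    using not_distinct_decomp by blast
  have pi: "partial_injection r" using assms(1) by (simp add: linkage_def)
  have "last p \<notin> Domain r" "set (vwalk_arcs p) \<subseteq> r"
    using assms by (auto simp: linkage_paths_def linkage_def)
  moreover have "set (vwalk_arcs (v # p3)) \<subseteq> set (vwalk_arcs (v # p2 @ v # p3))"
    using vwalk_arcs_middle[of "v # p2" v p3] by auto
  moreover have "set (vwalk_arcs p) = set (vwalk_arcs (p1 @ [v])) \<union> set (vwalk_arcs (v # p2 @ v # p3))"
    using vwalk_arcs_middle[of p1 v "p2 @ v # p3"] p by simp
  ultimately have "v # p2 @ v # p3 = v # p3"
    by (intro terminal_vwalk_unique[OF pi]) (auto simp: p simp del: vwalk_arcs_Cons)
  then have "length (v # p2 @ v # p3) = length (v # p3)" by (rule arg_cong)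
  then show False by simp
qed

text \<open>Following \<open>r\<close> from a cycle stays on it, whereas following \<open>p\<close>
  from \<open>v\<close> ends in \<open>Y\<close>, where no edge leaves.\<close>

lemma linkage_path_not_cyclic:
  assumes "linkage X Y r" "p \<in> linkage_paths X Y r" "v \<in> set p" "circular c" "c \<subseteq> r"
  shows "v \<notin> Domain c"
proof
  assume v: "v \<in> Domain c"
  have "(set (vwalk_arcs p))\<^sup>* \<subseteq> r\<^sup>*"
    using assms(2) by (intro rtrancl_mono) (auto simp: linkage_paths_def)
  with vwalk_rtrancl_last[OF assms(3)] have "(v, last p) \<in> r\<^sup>*" by blast
  with v assms(1) rtrancl_in_circular[OF _ assms(4,5)] have "last p \<in> Domain c"
    by (auto simp: linkage_def)
  with assms show False by (auto simp: linkage_def linkage_paths_def)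
qed

text \<open>Off the cycles, the walks forward and backward from \<open>v\<close> both come to an
  end; the equation between the two descriptions of the visited vertices places these ends in
  \<open>Y\<close> and \<open>X\<close>.\<close>

lemma linkage_path_through:
  assumes "linkage X Y r" "finite r" "v \<in> X \<union> Range r" "(v, v) \<notin> r\<^sup>+"
  obtains p where "p \<in> linkage_paths X Y r" "v \<in> set p"
proof -
  have pi: "partial_injection r" using assms(1) by (simp add: linkage_def)
  obtain t where t: "(v, t) \<in> r\<^sup>*" "t \<notin> Domain r" using reaches_terminal[OF pi assms(2,4)] .
  obtain s where s: "(s, v) \<in> r\<^sup>*" "s \<notin> Range r" using reaches_initial[OF pi assms(2,4)] .
  have v: "v \<in> Y \<union> Domain r" using assms(1,3) by (auto simp: linkage_def)
  \<comment> \<open>Either \<open>t = v\<close> or \<open>t\<close> is entered by the last edge of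
    the walk; in both cases \<open>t\<close> is visited, and having no outgoing edge it must lie in
    \<open>Y\<close>.\<close>
  have "t \<in> X \<union> Range r" using t(1) assms(3) by (cases rule: rtranclE) auto
  with t(2) assms(1) have "t \<in> Y" by (auto simp: linkage_def)
  have "s \<in> Y \<union> Domain r" using s(1) v by (cases rule: converse_rtranclE) auto
  with s(2) assms(1) have "s \<in> X" by (auto simp: linkage_def)
  obtain p where p: "p \<noteq> []" "hd p = s" "last p = v" "set (vwalk_arcs p) \<subseteq> r"
    using rtrancl_imp_vwalk[OF s(1)] .
  obtain q where q: "q \<noteq> []" "hd q = v" "last q = t" "set (vwalk_arcs q) \<subseteq> r"
    using rtrancl_imp_vwalk[OF t(1)] .
  obtain p' q' where pq: "p = p' @ [v]" "q = v # q'"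
    using p q by (metis append_butlast_last_id list.collapse)
  have "p' @ v # q' \<in> linkage_paths X Y r"
    unfolding linkage_paths_def
    using p q \<open>s \<in> X\<close> \<open>t \<in> Y\<close> vwalk_arcs_middle[of p' v q']
    by (auto simp: pq hd_append split: if_splits)
  with that show ?thesis by simp
qed

lemma inj_on_hd_linkage_paths:
  assumes "linkage X Y r"
  shows "inj_on hd (linkage_paths X Y r)"
proof (rule inj_onI)
  fix p q assume pq: "p \<in> linkage_paths X Y r" "q \<in> linkage_paths X Y r" "hd p = hd q"
  then have "p \<noteq> []" "q \<noteq> []" by (auto simp: linkage_paths_def)
  with pq(3) have "hd p \<in> set p" "hd p \<in> set q" by (metis hd_in_set)+
  with pq(1,2) show "p = q" by (rule linkage_paths_eq[OF assms])
qed

lemma hd_linkage_paths: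
  assumes "linkage X Y r" "finite r"
  shows "hd ` linkage_paths X Y r = X"
proof (intro equalityI subsetI)
  fix x assume x: "x \<in> X"
  then have "x \<notin> Range r" using assms(1) by (auto simp: linkage_def)
  then have "(x, x) \<notin> r\<^sup>+" by (metis RangeI tranclD2)
  with assms x obtain p where p: "p \<in> linkage_paths X Y r" "x \<in> set p"
    by (metis UnI1 linkage_path_through)
  then have "x = hd p"
    using \<open>x \<notin> Range r\<close> set_subset_vwalk_arcs[of p] by (auto simp: linkage_paths_def)
  with p show "x \<in> hd ` linkage_paths X Y r" by blast
qed (auto simp: linkage_paths_def)

lemma last_linkage_paths:
  assumes "linkage X Y r" "finite r"
  shows "last ` linkage_paths X Y r = Y"
proof (intro equalityI subsetI)
  fix y assume y: "y \<in> Y"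
  then have "y \<notin> Domain r" using assms(1) by (auto simp: linkage_def)
  then have "(y, y) \<notin> r\<^sup>+" by (metis DomainI tranclD)
  moreover have "y \<in> X \<union> Range r" using assms(1) y by (auto simp: linkage_def)
  ultimately obtain p where p: "p \<in> linkage_paths X Y r" "y \<in> set p"
    using assms by (metis linkage_path_through)
  then have "y = last p"
    using \<open>y \<notin> Domain r\<close> Domain_vwalk_arcs[OF distinct_linkage_path[OF assms(1) p(1)]]
    by (auto simp: linkage_paths_def)
  with p show "y \<in> last ` linkage_paths X Y r" by blast
qed (auto simp: linkage_paths_def)

text \<open>The tail \<open>a\<close> of an edge lies on a cycle, namely its component, or else on a
  path. As \<open>r\<close> is single-valued, the edge by which this cycle or path leaves
  \<open>a\<close> is the given one.\<close>

lemma flow_edges_linkage_flow: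
  assumes "linkage X Y r" "finite r"
  shows "flow_edges (linkage_flow X Y r) = r"
proof
  show "flow_edges (linkage_flow X Y r) \<subseteq> r"
    by (auto simp: flow_edges_def linkage_flow_def linkage_paths_def)
  have pi: "partial_injection r" using assms(1) by (simp add: linkage_def)
  show "r \<subseteq> flow_edges (linkage_flow X Y r)"
  proof (rule subrelI)
    fix a b assume ab: "(a, b) \<in> r"
    show "(a, b) \<in> flow_edges (linkage_flow X Y r)"
    proof (cases "(a, a) \<in> r\<^sup>+")
      case True
      have "(a, b) \<in> component r a" "component r a \<subseteq> r" using ab by (auto simp: component_def)
      with circular_component[OF pi assms(2) True] show ?thesis
        by (auto simp: flow_edges_def linkage_flow_def)
    next
      case False
      moreover have "a \<in> X \<union> Range r" using assms(1) ab by (auto simp: linkage_def)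
      ultimately obtain p where p: "p \<in> linkage_paths X Y r" "a \<in> set p"
        using assms by (metis linkage_path_through)
      then have "a \<noteq> last p"
        using assms(1) ab by (auto simp: linkage_def linkage_paths_def)
      then obtain c where c: "(a, c) \<in> set (vwalk_arcs p)"
        using p Domain_vwalk_arcs[OF distinct_linkage_path[OF assms(1) p(1)]]
        by (auto simp: linkage_paths_def)
      with p(1) have "(a, c) \<in> r" by (auto simp: linkage_paths_def)
      with ab have "c = b" using partial_injection_succ_eq[OF pi] by blast
      with c p(1) show ?thesis by (auto simp: flow_edges_def linkage_flow_def)
    qed
  qed
qed

section \<open>Passing between flows and edge sets\<close>

lemma linkage_flow_is_flow:
  assumes "pair_fin_digraph G" "linkage X Y r" "r \<subseteq> parcs G"
    and "X \<subseteq> pverts G" "card X = k" "Y \<subseteq> pverts G" "card Y = k"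
  shows "self_avoiding_flow G k X Y (linkage_flow X Y r)"
proof -
  interpret pair_fin_digraph G by fact
  let ?P = "linkage_paths X Y r"
  have "finite r" using assms(3) pair_finite_arcs by (rule finite_subset)
  note link = hd_linkage_paths[OF assms(2) this] last_linkage_paths[OF assms(2) this]
  have pi: "partial_injection r" using assms(2) by (simp add: linkage_def)
  note inj = inj_on_hd_linkage_paths[OF assms(2)]
  have "finite X" using assms(4) pair_finite_verts by (rule finite_subset)
  with inj link(1) have "finite ?P" by (metis finite_imageD)
  moreover have "card ?P = k" using inj link(1) assms(5) by (metis card_image)
  moreover have "vpath p (with_proj G)" if p: "p \<in> ?P" for p
  proof -
    have "set p \<subseteq> insert (hd p) (Range (set (vwalk_arcs p)))" "hd p \<in> X" "set (vwalk_arcs p) \<subseteq> r" "p \<noteq> []"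
      using p set_subset_vwalk_arcs by (auto simp: linkage_paths_def)
    moreover have "Range (parcs G) \<subseteq> pverts G" using in_arcsD2 by auto
    ultimately have "set p \<subseteq> pverts G" using assms(3,4) by blast
    with p assms(3) distinct_linkage_path[OF assms(2) p] show ?thesis
      by (auto simp: vpath_def vwalk_def linkage_paths_def)
  qed
  moreover have "pairwise (\<lambda>p q. disjnt (set p) (set q)) ?P"
    unfolding pairwise_def disjnt_iff using linkage_paths_eq[OF assms(2)] by blast
  moreover have "self_avoiding_cycle G c" if "c \<subseteq> r" "circular c" for c
    using that assms(3) self_avoiding_cycle_iff_circular[OF pair_wf_digraph_axioms] by blast
  moreover have "pairwise (\<lambda>c d. disjnt (cycle_verts c) (cycle_verts d)) {c. c \<subseteq> r \<and> circular c}"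
    unfolding pairwise_def disjnt_iff cycle_verts_eq_Field
    using circular_eq[OF pi] by (auto simp: Field_circular)
  moreover have "disjnt (set p) (cycle_verts c)" if "p \<in> ?P" "c \<subseteq> r" "circular c" for p c
    using linkage_path_not_cyclic[OF assms(2) that(1) _ that(3,2)] that(3)
    by (auto simp: disjnt_iff cycle_verts_eq_Field Field_circular)
  ultimately show ?thesis
    using assms link unfolding self_avoiding_flow_def linkage_flow_def by auto
qed

text \<open>The paths and cycles of a flow have edge sets with disjoint fields, so their union is a
  partial injection. A path misses only its last vertex in the domain and only its first vertex in
  the range, a cycle misses none.\<close>

lemma flow_components:
  assumes "pair_fin_digraph G" "self_avoiding_flow G k X Y F"
  shows "linkage X Y (flow_edges F)" "flow_edges F \<subseteq> parcs G"
    "flow_verts F = X \<union> Range (flow_edges F)"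
    "flow_verts F = Y \<union> Domain (flow_edges F)"
proof -
  interpret pair_fin_digraph G by fact
  let ?P = "flow_paths F" and ?C = "flow_cycles F"
  note flow = assms(2)[unfolded self_avoiding_flow_def]
  have path: "distinct p" "p \<noteq> []" "set (vwalk_arcs p) \<subseteq> parcs G" if "p \<in> ?P" for p
    using that flow by (auto simp: vpath_def vwalk_def)
  have cyc: "circular c" "c \<subseteq> parcs G" if "c \<in> ?C" for c
    using that flow self_avoiding_cycle_iff_circular[OF pair_wf_digraph_axioms] by auto
  have cv: "cycle_verts c = Domain c" "cycle_verts c = Range c" if "c \<in> ?C" for c
    using cyc[OF that] by (auto simp: cycle_verts_eq_Field Field_def circular_def)
  have pairs: "pairwise (\<lambda>p q. disjnt (set p) (set q)) ?P"
      "pairwise (\<lambda>c d. disjnt (cycle_verts c) (cycle_verts d)) ?C"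
    using flow by blast+
  have paths: "p = q" if "p \<in> ?P" "q \<in> ?P" "x \<in> set p" "x \<in> set q" for p q x
    using pairwiseD[OF pairs(1) that(1,2)] that(3,4) by (auto simp: disjnt_iff)
  have path_cycle: False if "p \<in> ?P" "c \<in> ?C" "x \<in> set p" "x \<in> cycle_verts c" for p c x
    using flow that unfolding disjnt_iff by blast
  have cycles: "c = d" if "c \<in> ?C" "d \<in> ?C" "x \<in> cycle_verts c" "x \<in> cycle_verts d" for c d x
    using pairwiseD[OF pairs(2) that(1,2)] that(3,4) by (auto simp: disjnt_iff)
  let ?K = "(\<lambda>p. set (vwalk_arcs p)) ` ?P \<union> ?C"
  have edges: "flow_edges F = \<Union>?K" by (auto simp: flow_edges_def)
  have fieldp: "x \<in> set p" if "x \<in> Field (set (vwalk_arcs p))" for x p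
    using that set_vwalk_arcs_subset[of p] by (auto simp: Field_def)
  have "r = s" if "r \<in> ?K" "s \<in> ?K" "x \<in> Field r" "x \<in> Field s" for r s x
  proof -
    note rs = that
    consider "r \<in> ?C" "s \<in> ?C"
      | p q where "p \<in> ?P" "q \<in> ?P" "r = set (vwalk_arcs p)" "s = set (vwalk_arcs q)"
      | p c where "p \<in> ?P" "c \<in> ?C" "x \<in> Field (set (vwalk_arcs p))" "x \<in> Field c"
      using rs by blast
    then show ?thesis
    proof cases
      case 1
      with that(3,4) cycles[of r s x] show ?thesis by (simp add: cycle_verts_eq_Field)
    next
      case 2
      with that(3,4) fieldp have "x \<in> set p" "x \<in> set q" by auto
      with 2 paths[of p q x] show ?thesis by simp
    next
      case 3
      with path_cycle[of p c x] fieldp[of x p] show ?thesis by (simp add: cycle_verts_eq_Field)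
    qed
  qed
  then have "pairwise (\<lambda>r s. disjnt (Field r) (Field s)) ?K"
    unfolding pairwise_def disjnt_iff by blast
  moreover have "partial_injection r" if "r \<in> ?K" for r
    using that path(1) cyc(1) partial_injection_vwalk_arcs by (auto simp: circular_def)
  ultimately have pi: "partial_injection (flow_edges F)"
    unfolding edges by (intro partial_injection_Union) auto
  have XY: "X = hd ` ?P" "Y = last ` ?P" using flow by auto
  have dom: "Domain (flow_edges F) = (\<Union>p\<in>?P. set p - {last p}) \<union> (\<Union>c\<in>?C. cycle_verts c)"
  proof -
    have "(\<Union>c\<in>?C. cycle_verts c) = (\<Union>c\<in>?C. Domain c)" using cv(1) by (rule SUP_cong[OF refl])
    then show ?thesis
      by (simp add: edges Domain_Union Domain_Un_eq Domain_vwalk_arcs path)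
  qed
  have ran: "Range (flow_edges F) = (\<Union>p\<in>?P. set p - {hd p}) \<union> (\<Union>c\<in>?C. cycle_verts c)"
  proof -
    have "(\<Union>c\<in>?C. cycle_verts c) = (\<Union>c\<in>?C. Range c)" using cv(2) by (rule SUP_cong[OF refl])
    then show ?thesis
      by (simp add: edges Range_Union Range_Un_eq Range_vwalk_arcs path)
  qed
  have ends: "hd p \<in> set p" "last p \<in> set p" if "p \<in> ?P" for p
    using path(2)[OF that] by auto
  have "X \<inter> Range (flow_edges F) = {}"
  proof (rule ccontr)
    assume "X \<inter> Range (flow_edges F) \<noteq> {}"
    then obtain p where p: "p \<in> ?P" "hd p \<in> Range (flow_edges F)" using XY by auto
    then have "hd p \<in> set p" using ends by simp
    with p paths[of p] path_cycle[of p] show False unfolding ran by auto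
  qed
  moreover have "Y \<inter> Domain (flow_edges F) = {}"
  proof (rule ccontr)
    assume "Y \<inter> Domain (flow_edges F) \<noteq> {}"
    then obtain p where p: "p \<in> ?P" "last p \<in> Domain (flow_edges F)" using XY by auto
    then have "last p \<in> set p" using ends by simp
    with p paths[of p] path_cycle[of p] show False unfolding dom by auto
  qed
  moreover show fv: "flow_verts F = X \<union> Range (flow_edges F)"
    unfolding ran XY(1) flow_verts_def using ends by blast
  moreover show "flow_verts F = Y \<union> Domain (flow_edges F)"
    unfolding dom XY(2) flow_verts_def using ends by blast
  ultimately show "linkage X Y (flow_edges F)" using pi by (simp add: linkage_def)
  show "flow_edges F \<subseteq> parcs G" using path(3) cyc(2) by (auto simp: edges)
qed

text \<open>A flow is determined by its edges. A path of the linkage meets the path of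
  \<open>F\<close> with the same first vertex. A cycle in the edge set shares an edge with a piece
  of \<open>F\<close>; this piece cannot be a path, so it is a cycle and equals the given
  one.\<close>

lemma flow_eq_linkage_flow:
  assumes "pair_fin_digraph G" "self_avoiding_flow G k X Y F"
  shows "F = linkage_flow X Y (flow_edges F)"
proof -
  interpret pair_fin_digraph G by fact
  let ?r = "flow_edges F"
  note flow = assms(2)[unfolded self_avoiding_flow_def]
  have link: "linkage X Y ?r" by (rule flow_components[OF assms])
  then have pi: "partial_injection ?r" by (simp add: linkage_def)
  have sub: "flow_paths F \<subseteq> linkage_paths X Y ?r"
    using flow by (auto simp: linkage_paths_def flow_edges_def vpath_def vwalk_def)
  moreover have "linkage_paths X Y ?r \<subseteq> flow_paths F"
  proof
    fix p assume p: "p \<in> linkage_paths X Y ?r"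
    then have "hd p \<in> hd ` flow_paths F" "p \<noteq> []" using flow by (auto simp: linkage_paths_def)
    then obtain q where q: "q \<in> flow_paths F" "hd p = hd q" by auto
    with sub have "q \<in> linkage_paths X Y ?r" by auto
    moreover from this have "hd p \<in> set q" using q(2) by (simp add: linkage_paths_def)
    moreover have "hd p \<in> set p" using \<open>p \<noteq> []\<close> by simp
    ultimately have "p = q" using linkage_paths_eq[OF link p] by blast
    with q show "p \<in> flow_paths F" by simp
  qed
  moreover have cyc: "flow_cycles F \<subseteq> {c. c \<subseteq> ?r \<and> circular c}"
    using flow self_avoiding_cycle_iff_circular[OF pair_wf_digraph_axioms]
    by (auto simp: flow_edges_def)
  moreover have "{c. c \<subseteq> ?r \<and> circular c} \<subseteq> flow_cycles F"
  proof
    fix c assume "c \<in> {c. c \<subseteq> ?r \<and> circular c}"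
    then have c: "c \<subseteq> ?r" "circular c" by auto
    then obtain a b where ab: "(a, b) \<in> c" by (auto simp: circular_def)
    with c(1) consider p where "p \<in> flow_paths F" "(a, b) \<in> set (vwalk_arcs p)"
      | d where "d \<in> flow_cycles F" "(a, b) \<in> d"
      by (auto simp: flow_edges_def)
    then show "c \<in> flow_cycles F"
    proof cases
      case 1
      then have "a \<in> set p" using set_vwalk_arcs_subset by fastforce
      with linkage_path_not_cyclic[OF link _ _ c(2,1), of p a] 1 sub ab show ?thesis by auto
    next
      case 2
      then have "circular d" "d \<subseteq> ?r" using cyc by auto
      with circular_eq[OF pi c(2,1), of d a] 2 ab have "c = d" by auto
      with 2 show ?thesis by simp
    qed
  qed
  ultimately show ?thesis by (simp add: linkage_flow_def prod_eq_iff)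
qed

section \<open>Exchanging edges between two flows\<close>

text \<open>The arcs of the up-down digraph in terms of \<open>S\<close>, \<open>L\<close> and
  \<open>R\<close> alone: the visited vertices of a flow are written as its sources together with
  the heads of its edges.\<close>

definition up_down_rel :: "'v set \<Rightarrow> 'v rel \<Rightarrow> 'v rel \<Rightarrow> ('v \<times> 'v) rel" where
  "up_down_rel S L R = {(e, f). e \<in> sym_diff L R \<and> f \<in> sym_diff L R \<and>
     (e \<in> L \<and> (if snd e \<in> S \<union> Range R then f \<in> R \<and> snd f = snd e else f \<in> L \<and> fst f = snd e) \<or>
      e \<in> R \<and> (if fst e \<in> S \<union> Range L then f \<in> L \<and> fst f = fst e else f \<in> R \<and> snd f = fst e))}"

text \<open>Exchanging the two flows reverses the digraph of up-down cycles. This symmetry reduces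
  injectivity to single-valuedness, and predecessors to successors.\<close>

lemma up_down_rel_converse_subset:
  assumes "linkage S A L" "linkage S B R"
  shows "(up_down_rel S L R)\<inverse> \<subseteq> up_down_rel S R L"
proof (rule subrelI)
  fix f e assume "(f, e) \<in> (up_down_rel S L R)\<inverse>"
  \<comment> \<open>These equations make a vertex with an outgoing edge count as visited, as needed
    when \<open>e\<close> and \<open>f\<close> have the same tail.\<close>
  moreover have "S \<union> Range L = A \<union> Domain L" "S \<union> Range R = B \<union> Domain R"
    using assms by (auto simp: linkage_def)
  moreover obtain x y u v where "e = (x, y)" "f = (u, v)" by fastforce
  ultimately show "(f, e) \<in> up_down_rel S R L"
    unfolding up_down_rel_def by (simp split: if_splits) blast+
qed

lemma up_down_rel_converse:
  assumes "linkage S A L" "linkage S B R"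
  shows "(up_down_rel S L R)\<inverse> = up_down_rel S R L"
proof
  have "((up_down_rel S R L)\<inverse>)\<inverse> \<subseteq> (up_down_rel S L R)\<inverse>"
    using up_down_rel_converse_subset[OF assms(2,1)] by (rule converse_mono[THEN iffD2])
  then show "up_down_rel S R L \<subseteq> (up_down_rel S L R)\<inverse>" by simp
qed (rule up_down_rel_converse_subset[OF assms])

text \<open>An unshared edge belongs to only one of the two flows, so one rule applies; it
  prescribes the head or the tail of the next edge within one partial injection.\<close>

lemma single_valued_up_down_rel:
  assumes "linkage S A L" "linkage S B R"
  shows "single_valued (up_down_rel S L R)"
proof (rule single_valuedI)
  fix e f g assume "(e, f) \<in> up_down_rel S L R" "(e, g) \<in> up_down_rel S L R"
  moreover have "partial_injection L" "partial_injection R"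
    using assms by (auto simp: linkage_def)
  moreover obtain x y u v u' v' where "e = (x, y)" "f = (u, v)" "g = (u', v')" by (metis surj_pair)
  ultimately show "f = g"
    unfolding up_down_rel_def
    by (auto split: if_splits dest: partial_injection_succ_eq partial_injection_pred_eq)
qed

lemma partial_injection_up_down_rel:
  assumes "linkage S A L" "linkage S B R"
  shows "partial_injection (up_down_rel S L R)"
  using single_valued_up_down_rel[OF assms] single_valued_up_down_rel[OF assms(2,1)]
  by (simp add: partial_injection_def up_down_rel_converse[OF assms])

text \<open>\<open>alternating S L R U\<close> says that \<open>U\<close> contains successors in the up-down digraph of its elements, so
  that \<open>alternating S R L U\<close> says that it contains predecessors.\<close>

definition alternating :: "'v set \<Rightarrow> 'v rel \<Rightarrow> 'v rel \<Rightarrow> 'v rel \<Rightarrow> bool" where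
  "alternating S L R U \<longleftrightarrow>
     (\<forall>x y. (x, y) \<in> U \<inter> L \<longrightarrow>
        (\<exists>z. (z, y) \<in> U \<inter> R) \<or> y \<notin> S \<union> Range R \<and> (\<exists>z. (y, z) \<in> U \<inter> L)) \<and>
     (\<forall>x y. (x, y) \<in> U \<inter> R \<longrightarrow>
        (\<exists>z. (x, z) \<in> U \<inter> L) \<or> x \<notin> S \<union> Range L \<and> (\<exists>z. (z, x) \<in> U \<inter> R))"

text \<open>The case distinction on visited vertices becomes a disjunction in
  \<open>alternating\<close>: an edge of \<open>R\<close> entering \<open>y\<close>, or an edge of
  \<open>L\<close> leaving \<open>x\<close>, already shows that the vertex is visited by that
  flow.\<close>

lemma successors_iff_alternating:
  assumes "linkage S A L" "linkage S B R" "U \<subseteq> sym_diff L R"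
  shows "(\<forall>e \<in> U. \<exists>f \<in> U. (e, f) \<in> up_down_rel S L R) \<longleftrightarrow> alternating S L R U"
proof
  assume succ: "\<forall>e \<in> U. \<exists>f \<in> U. (e, f) \<in> up_down_rel S L R"
  show "alternating S L R U"
    unfolding alternating_def
  proof (intro conjI allI impI)
    fix x y assume e: "(x, y) \<in> U \<inter> L"
    then obtain f where "f \<in> U" "((x, y), f) \<in> up_down_rel S L R" using succ by blast
    with e assms(3) show "(\<exists>z. (z, y) \<in> U \<inter> R) \<or> y \<notin> S \<union> Range R \<and> (\<exists>z. (y, z) \<in> U \<inter> L)"
      by (cases f) (auto simp: up_down_rel_def split: if_splits)
  next
    fix x y assume e: "(x, y) \<in> U \<inter> R"
    then obtain f where "f \<in> U" "((x, y), f) \<in> up_down_rel S L R" using succ by blast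
    with e assms(3) show "(\<exists>z. (x, z) \<in> U \<inter> L) \<or> x \<notin> S \<union> Range L \<and> (\<exists>z. (z, x) \<in> U \<inter> R)"
      by (cases f) (auto simp: up_down_rel_def split: if_splits)
  qed
next
  assume alt: "alternating S L R U"
  have W: "Domain L \<subseteq> S \<union> Range L" using assms(1) by (auto simp: linkage_def)
  show "\<forall>e \<in> U. \<exists>f \<in> U. (e, f) \<in> up_down_rel S L R"
  proof
    fix e assume e: "e \<in> U"
    obtain x y where xy: "e = (x, y)" by fastforce
    from e assms(3) xy consider "(x, y) \<in> U \<inter> L" "(x, y) \<notin> R" | "(x, y) \<in> U \<inter> R" "(x, y) \<notin> L" by blast
    then show "\<exists>f \<in> U. (e, f) \<in> up_down_rel S L R"
    proof cases
      case 1
      with alt consider z where "(z, y) \<in> U \<inter> R" | z where "y \<notin> S \<union> Range R" "(y, z) \<in> U \<inter> L"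
        unfolding alternating_def by blast
      then show ?thesis
      proof cases
        case (1 z)
        then have "y \<in> Range R" by auto
        with 1 \<open>(x, y) \<in> U \<inter> L\<close> assms(3) xy have "(e, (z, y)) \<in> up_down_rel S L R"
          by (auto simp: up_down_rel_def)
        with 1 show ?thesis by blast
      next
        case (2 z)
        with \<open>(x, y) \<in> U \<inter> L\<close> assms(3) xy have "(e, (y, z)) \<in> up_down_rel S L R"
          by (auto simp: up_down_rel_def)
        with 2 show ?thesis by blast
      qed
    next
      case 2
      with alt consider z where "(x, z) \<in> U \<inter> L" | z where "x \<notin> S \<union> Range L" "(z, x) \<in> U \<inter> R"
        unfolding alternating_def by blast
      then show ?thesis
      proof cases
        case (1 z)
        then have "x \<in> S \<union> Range L" using W by auto
        with 1 \<open>(x, y) \<in> U \<inter> R\<close> assms(3) xy have "(e, (x, z)) \<in> up_down_rel S L R"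
          by (auto simp: up_down_rel_def)
        with 1 show ?thesis by blast
      next
        case (2 z)
        with \<open>(x, y) \<in> U \<inter> R\<close> assms(3) xy have "(e, (z, x)) \<in> up_down_rel S L R"
          by (auto simp: up_down_rel_def)
        with 2 show ?thesis by blast
      qed
    qed
  qed
qed

lemma invariant_set_up_down_rel:
  assumes "linkage S A L" "linkage S B R"
  shows "invariant_set (up_down_rel S L R) U \<longleftrightarrow>
    U \<subseteq> sym_diff L R \<and> alternating S L R U \<and> alternating S R L U"
proof (cases "U \<subseteq> sym_diff L R")
  case True
  then have "U \<subseteq> sym_diff R L" by blast
  have "invariant_set (up_down_rel S L R) U \<longleftrightarrow>
      (\<forall>e \<in> U. \<exists>f \<in> U. (e, f) \<in> up_down_rel S L R) \<and>
      (\<forall>e \<in> U. \<exists>f \<in> U. (e, f) \<in> up_down_rel S R L)"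
    unfolding invariant_set_def up_down_rel_converse[OF assms, symmetric] converse_iff by blast
  with successors_iff_alternating[OF assms True]
    successors_iff_alternating[OF assms(2,1) \<open>U \<subseteq> sym_diff R L\<close>] True show ?thesis by simp
next
  case False
  then show ?thesis by (auto simp: invariant_set_def up_down_rel_def)
qed

text \<open>All conditions of a linkage are checked one vertex at a time. Only the first flow is
  treated; exchanging the roles of \<open>L\<close> and \<open>R\<close> gives the second.\<close>

lemma alternating_imp_linkage:
  assumes L: "linkage S A L" and R: "linkage S B R" and U: "U \<subseteq> sym_diff L R"
    and "alternating S L R U" "alternating S R L U"
  shows "linkage S A (sym_diff L U)"
proof -
  have Ls: "x = y" if "(w, x) \<in> L" "(w, y) \<in> L" for w x y
    using L that by (auto simp: linkage_def dest: partial_injection_succ_eq)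
  have Lp: "x = y" if "(x, w) \<in> L" "(y, w) \<in> L" for w x y
    using L that by (auto simp: linkage_def dest: partial_injection_pred_eq)
  have Rs: "x = y" if "(w, x) \<in> R" "(w, y) \<in> R" for w x y
    using R that by (auto simp: linkage_def dest: partial_injection_succ_eq)
  have Rp: "x = y" if "(x, w) \<in> R" "(y, w) \<in> R" for w x y
    using R that by (auto simp: linkage_def dest: partial_injection_pred_eq)
  have Lv: "v \<in> S \<or> (\<exists>u. (u, v) \<in> L) \<longleftrightarrow> v \<in> A \<or> (\<exists>w. (v, w) \<in> L)" for v
    using L unfolding linkage_def by blast
  have Rv: "v \<in> S \<or> (\<exists>u. (u, v) \<in> R) \<longleftrightarrow> v \<in> B \<or> (\<exists>w. (v, w) \<in> R)" for v
    using R unfolding linkage_def by blast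
  have SA: "v \<in> S \<Longrightarrow> (u, v) \<notin> L" "v \<in> S \<Longrightarrow> (u, v) \<notin> R" "v \<in> A \<Longrightarrow> (v, u) \<notin> L" for u v
  proof -
    have "S \<inter> Range L = {}" "S \<inter> Range R = {}" "A \<inter> Domain L = {}"
      using L R by (simp_all add: linkage_def)
    then show "v \<in> S \<Longrightarrow> (u, v) \<notin> L" "v \<in> S \<Longrightarrow> (u, v) \<notin> R" "v \<in> A \<Longrightarrow> (v, u) \<notin> L"
      by auto
  qed
  \<comment> \<open>The facts \<open>out_L\<close> and \<open>out_R\<close> express successors in
    the up-down digraph, \<open>in_R\<close> and \<open>in_L\<close> predecessors.\<close>
  have out_L: "(\<exists>z. (z, y) \<in> U \<and> (z, y) \<in> R) \<or>
      y \<notin> S \<and> (\<forall>z. (z, y) \<notin> R) \<and> (\<exists>z. (y, z) \<in> U \<and> (y, z) \<in> L)"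
    if "(x, y) \<in> U" "(x, y) \<in> L" for x y
    using assms(4) that unfolding alternating_def by blast
  have out_R: "(\<exists>z. (x, z) \<in> U \<and> (x, z) \<in> L) \<or>
      x \<notin> S \<and> (\<forall>z. (z, x) \<notin> L) \<and> (\<exists>z. (z, x) \<in> U \<and> (z, x) \<in> R)"
    if "(x, y) \<in> U" "(x, y) \<in> R" for x y
    using assms(4) that unfolding alternating_def by blast
  have in_R: "(\<exists>z. (z, y) \<in> U \<and> (z, y) \<in> L) \<or>
      y \<notin> S \<and> (\<forall>z. (z, y) \<notin> L) \<and> (\<exists>z. (y, z) \<in> U \<and> (y, z) \<in> R)"
    if "(x, y) \<in> U" "(x, y) \<in> R" for x y
    using assms(5) that unfolding alternating_def by blast
  have in_L: "(\<exists>z. (x, z) \<in> U \<and> (x, z) \<in> R) \<or>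
      x \<notin> S \<and> (\<forall>z. (z, x) \<notin> R) \<and> (\<exists>z. (z, x) \<in> U \<and> (z, x) \<in> L)"
    if "(x, y) \<in> U" "(x, y) \<in> L" for x y
    using assms(5) that unfolding alternating_def by blast
  have UE: "e \<in> L \<and> e \<notin> R \<or> e \<in> R \<and> e \<notin> L" if "e \<in> U" for e using U that by blast
  let ?L = "sym_diff L U"
  have L': "e \<in> ?L \<longleftrightarrow> e \<in> L \<and> e \<notin> U \<or> e \<in> R \<and> e \<in> U" for e
    using UE[of e] by blast
  have "single_valued ?L"
  proof (rule single_valuedI)
    fix x y z assume a: "(x, y) \<in> ?L" "(x, z) \<in> ?L"
    \<comment> \<open>Two edges of the new set with a common tail and different origin:
      \<open>out_R\<close> gives an edge of \<open>U \<inter> L\<close> leaving \<open>x\<close>,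
      which must be the one outside \<open>U\<close>. The other alternative of \<open>out_R\<close>
      fails as \<open>L\<close> visits \<open>x\<close>.\<close>
    have False if "(x, u) \<in> L" "(x, u) \<notin> U" "(x, w) \<in> R" "(x, w) \<in> U" for u w
      using out_R[OF that(4,3)] Ls that(1,2) Lv by metis
    with a Ls Rs show "y = z" unfolding L' by metis
  qed
  moreover have "single_valued (?L\<inverse>)"
  proof (rule single_valuedI)
    fix x y z assume "(x, y) \<in> ?L\<inverse>" "(x, z) \<in> ?L\<inverse>"
    then have a: "(y, x) \<in> ?L" "(z, x) \<in> ?L" by blast+
    have False if "(u, x) \<in> L" "(u, x) \<notin> U" "(w, x) \<in> R" "(w, x) \<in> U" for u w
      using in_R[OF that(4,3)] Lp that(1,2) by metis
    with a Lp Rp show "y = z" unfolding L' by metis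
  qed
  moreover have "S \<inter> Range ?L = {}" using SA(1,2) L' by blast
  moreover have "A \<inter> Domain ?L = {}"
  proof -
    \<comment> \<open>Such an edge would come from \<open>U \<inter> R\<close>. Then
      \<open>out_R\<close> asks for an edge of \<open>L\<close> leaving \<open>x\<close> or for
      \<open>x\<close> not visited by \<open>L\<close>, and \<open>x \<in> A\<close> excludes
      both.\<close>
    have False if "x \<in> A" "(x, z) \<in> ?L" for x z
      using that SA(3) L' out_R Lv by metis
    then show ?thesis by blast
  qed
  \<comment> \<open>An edge of \<open>L\<close> leaving \<open>v\<close> is kept or lies in
    \<open>U\<close>. In the latter case \<open>in_L\<close> yields an edge of
    \<open>U \<inter> R\<close> leaving \<open>v\<close>, as its other alternative conflicts with
    the way \<open>v\<close> is entered. If no edge of \<open>L\<close> enters \<open>v\<close> in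
    the third case, \<open>in_R\<close> gives the outgoing edge.\<close>
  moreover have "S \<union> Range ?L \<subseteq> A \<union> Domain ?L"
  proof
    fix v assume "v \<in> S \<union> Range ?L"
    then consider "v \<in> S" | u where "(u, v) \<in> L" "(u, v) \<notin> U" | u where "(u, v) \<in> R" "(u, v) \<in> U"
      using L' by blast
    then have "v \<in> A \<or> (\<exists>w. (v, w) \<in> ?L)"
    proof cases
      case 1
      then show ?thesis using Lv[of v] in_L L' by metis
    next
      case 2
      then show ?thesis using Lv[of v] in_L[of v] Lp L' by metis
    next
      case 3
      then show ?thesis using Lv[of v] in_R[of u v] in_L[of v] L' by metis
    qed
    then show "v \<in> A \<union> Domain ?L" by blast
  qed
  moreover have "A \<union> Domain ?L \<subseteq> S \<union> Range ?L"
  proof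
    fix v assume "v \<in> A \<union> Domain ?L"
    then consider "v \<in> A" | w where "(v, w) \<in> L" "(v, w) \<notin> U" | w where "(v, w) \<in> R" "(v, w) \<in> U"
      using L' by blast
    then have "v \<in> S \<or> (\<exists>u. (u, v) \<in> ?L)"
    proof cases
      case 1
      then show ?thesis using Lv[of v] out_L[of _ v] SA(3) L' by metis
    next
      case 2
      then show ?thesis using Lv[of v] out_L[of _ v] Ls L' by metis
    next
      case 3
      then show ?thesis using Lv[of v] Rv[of v] out_R[of v w] out_L[of _ v] L' by metis
    qed
    then show "v \<in> S \<union> Range ?L" by blast
  qed
  ultimately show ?thesis by (simp add: linkage_def partial_injection_def subset_antisym)
qed

text \<open>An edge of \<open>U \<inter> L\<close> entering \<open>y\<close> moves to the second
  flow. If \<open>R\<close> already enters \<open>y\<close>, that edge must move away; if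
  \<open>R\<close> does not visit \<open>y\<close>, the new second flow must leave \<open>y\<close>
  along an edge of \<open>U \<inter> L\<close>. Edges of \<open>U \<inter> R\<close> are treated
  likewise at their tails.\<close>

lemma linkage_imp_alternating:
  assumes L: "linkage S A L" and R: "linkage S B R" and U: "U \<subseteq> sym_diff L R"
    and L': "linkage S A (sym_diff L U)" and R': "linkage S B (sym_diff R U)"
  shows "alternating S L R U"
  unfolding alternating_def
proof (intro conjI allI impI)
  have sL: "S \<union> Range L = A \<union> Domain L" "S \<inter> Range L = {}" "A \<inter> Domain L = {}"
    and sR: "S \<union> Range R = B \<union> Domain R" "S \<inter> Range R = {}"
    and sL': "S \<union> Range (sym_diff L U) = A \<union> Domain (sym_diff L U)" "A \<inter> Domain (sym_diff L U) = {}"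
    and sR': "S \<union> Range (sym_diff R U) = B \<union> Domain (sym_diff R U)" "S \<inter> Range (sym_diff R U) = {}"
    using assms by (auto simp: linkage_def)
  have pL': "partial_injection (sym_diff L U)" and pR': "partial_injection (sym_diff R U)"
    using L' R' by (auto simp: linkage_def)
  {
    fix x y assume e: "(x, y) \<in> U \<inter> L"
    then have e': "(x, y) \<in> sym_diff R U" "(x, y) \<notin> R" "y \<notin> S" using U sL by auto
    show "(\<exists>z. (z, y) \<in> U \<inter> R) \<or> y \<notin> S \<union> Range R \<and> (\<exists>z. (y, z) \<in> U \<inter> L)"
    proof (cases "y \<in> S \<union> Range R")
      case True
      with e' obtain z where z: "(z, y) \<in> R" by auto
      have "(z, y) \<in> U"
      proof (rule ccontr)
        assume "(z, y) \<notin> U"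
        with z have "(z, y) \<in> sym_diff R U" by blast
        with e' partial_injection_pred_eq[OF pR'] have "z = x" by blast
        with z e' show False by simp
      qed
      with z show ?thesis by blast
    next
      case False
      have "y \<in> B \<union> Domain (sym_diff R U)" using e' sR' by blast
      moreover have "y \<notin> B" "y \<notin> Domain R" using False sR by blast+
      ultimately obtain z where "(y, z) \<in> U" "(y, z) \<notin> R" by blast
      with U False show ?thesis by blast
    qed
  next
    fix x y assume e: "(x, y) \<in> U \<inter> R"
    then have e': "(x, y) \<in> sym_diff L U" "(x, y) \<notin> L" using U by auto
    then have "x \<notin> A" using sL' by blast
    show "(\<exists>z. (x, z) \<in> U \<inter> L) \<or> x \<notin> S \<union> Range L \<and> (\<exists>z. (z, x) \<in> U \<inter> R)"
    proof (cases "x \<in> S \<union> Range L")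
      case True
      with sL \<open>x \<notin> A\<close> obtain z where z: "(x, z) \<in> L" by blast
      have "(x, z) \<in> U"
      proof (rule ccontr)
        assume "(x, z) \<notin> U"
        with z have "(x, z) \<in> sym_diff L U" by blast
        with e' partial_injection_succ_eq[OF pL'] have "z = y" by blast
        with z e' show False by simp
      qed
      with z show ?thesis by blast
    next
      case False
      have "x \<in> S \<union> Range (sym_diff L U)" using e' sL' by blast
      with False obtain z where "(z, x) \<in> U" "(z, x) \<notin> L" by blast
      with U False show ?thesis by blast
    qed
  }
qed

lemma invariant_set_up_down_rel_iff_linkage:
  assumes "linkage S A L" "linkage S B R"
  shows "invariant_set (up_down_rel S L R) U \<longleftrightarrow>
    U \<subseteq> sym_diff L R \<and> linkage S A (sym_diff L U) \<and> linkage S B (sym_diff R U)"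
proof (cases "U \<subseteq> sym_diff L R")
  case True
  then have "U \<subseteq> sym_diff R L" by blast
  then show ?thesis
    using True invariant_set_up_down_rel[OF assms] alternating_imp_linkage[OF assms True]
      alternating_imp_linkage[OF assms(2,1)] linkage_imp_alternating[OF assms True]
      linkage_imp_alternating[OF assms(2,1)] by blast
next
  case False
  then show ?thesis using invariant_set_up_down_rel[OF assms] by blast
qed

section \<open>Monomials and the count\<close>

lemma finite_linkage_paths:
  assumes "linkage X Y r" "finite X"
  shows "finite (linkage_paths X Y r)"
proof -
  have "hd ` linkage_paths X Y r \<subseteq> X" by (auto simp: linkage_paths_def)
  with inj_on_hd_linkage_paths[OF assms(1)] assms(2) show ?thesis
    by (meson finite_imageD finite_subset)
qed

text \<open>Within one flow every edge lies on exactly one path or cycle and is used there once, so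
  the nested products merge into one over \<open>r\<close>.\<close>

lemma flow_monomial_linkage_flow:
  assumes "linkage X Y r" "finite r" "finite X"
  shows "flow_monomial (linkage_flow X Y r) = (\<Prod>e \<in> r. lam e)"
proof -
  let ?P = "linkage_paths X Y r" and ?C = "{c. c \<subseteq> r \<and> circular c}"
  have pi: "partial_injection r" using assms(1) by (simp add: linkage_def)
  have fin: "finite ?P" "finite ?C"
    using finite_linkage_paths assms by (auto intro: finite_subset[of _ "Pow r"])
  have verts: "fst e \<in> set p" if "e \<in> set (vwalk_arcs p)" for e and p :: "'a list"
    using that set_vwalk_arcs_subset by fastforce
  have "(\<Prod>p \<in> ?P. \<Prod>e\<leftarrow>vwalk_arcs p. lam e) = (\<Prod>p \<in> ?P. \<Prod>e \<in> set (vwalk_arcs p). lam e)"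
    by (intro prod.cong refl prod.distinct_set_conv_list[symmetric] distinct_vwalk_arcs
        distinct_linkage_path[OF assms(1)])
  also have "\<dots> = (\<Prod>e \<in> (\<Union>p \<in> ?P. set (vwalk_arcs p)). lam e)"
  \<comment> \<open>Several empty paths contribute the same empty edge set, so the product rule for
    disjoint, possibly repeated, sets is used.\<close>
  proof (rule prod.UNION_disjoint[symmetric])
    show "\<forall>p\<in>?P. \<forall>q\<in>?P. p \<noteq> q \<longrightarrow> set (vwalk_arcs p) \<inter> set (vwalk_arcs q) = {}"
      using linkage_paths_eq[OF assms(1)] verts by blast
  qed (use fin in auto)
  finally have paths: "(\<Prod>p \<in> ?P. \<Prod>e\<leftarrow>vwalk_arcs p. lam e) =
    (\<Prod>e \<in> (\<Union>p \<in> ?P. set (vwalk_arcs p)). lam e)" .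
  have "c \<inter> d = {}" if "c \<in> ?C" "d \<in> ?C" "c \<noteq> d" for c d
  proof (rule ccontr)
    assume "c \<inter> d \<noteq> {}"
    then obtain a b where "(a, b) \<in> c" "(a, b) \<in> d" by auto
    with that circular_eq[OF pi, of c d a] show False by auto
  qed
  then have cycles: "(\<Prod>c \<in> ?C. \<Prod>e \<in> c. lam e) = (\<Prod>e \<in> \<Union>?C. lam e)"
    by (subst prod.Union_disjoint) (auto simp: circular_def)
  have "(\<Union>p \<in> ?P. set (vwalk_arcs p)) \<inter> \<Union>?C = {}"
  proof (rule ccontr)
    assume "(\<Union>p \<in> ?P. set (vwalk_arcs p)) \<inter> \<Union>?C \<noteq> {}"
    then obtain a b p c where *: "p \<in> ?P" "(a, b) \<in> set (vwalk_arcs p)"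
        "(a, b) \<in> c" "c \<subseteq> r" "circular c" by fastforce
    then have "a \<in> set p" using verts[of "(a, b)" p] by simp
    with * linkage_path_not_cyclic[OF assms(1) *(1) _ *(5,4)] show False by blast
  qed
  moreover have "finite (\<Union>p \<in> ?P. set (vwalk_arcs p))" "finite (\<Union>?C)"
    using fin by (auto simp: circular_def)
  ultimately have "flow_monomial (linkage_flow X Y r) =
      (\<Prod>e \<in> (\<Union>p \<in> ?P. set (vwalk_arcs p)) \<union> \<Union>?C. lam e)"
    by (simp add: flow_monomial_def linkage_flow_def paths cycles prod.union_disjoint)
  also have "(\<Union>p \<in> ?P. set (vwalk_arcs p)) \<union> \<Union>?C = r"
    using flow_edges_linkage_flow[OF assms(1,2)] by (simp add: flow_edges_def linkage_flow_def)
  finally show ?thesis .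
qed

section \<open>Monomials as exponent vectors\<close>

lemma prod_indeterminate:
  "(\<Prod>i \<in> I. indeterminate (f i)) = Poly_Mapping.single (\<Sum>i \<in> I. Poly_Mapping.single (f i) 1) 1"
  by (induction I rule: infinite_finite_induct)
    (simp_all add: indeterminate_def mult_single)

lemma lookup_sum_single:
  assumes "finite I" "inj_on f I"
  shows "Poly_Mapping.lookup (\<Sum>i \<in> I. Poly_Mapping.single (f i) (1 :: nat)) x = of_bool (x \<in> f ` I)"
proof -
  have "Poly_Mapping.lookup (\<Sum>i \<in> I. Poly_Mapping.single (f i) (1 :: nat)) x =
      (\<Sum>i \<in> I. if f i = x then 1 else 0)"
    by (simp add: lookup_sum lookup_single when_def del: One_nat_def)
  also have "\<dots> = (\<Sum>y \<in> f ` I. if y = x then 1 else 0)"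
    by (simp add: sum.reindex[OF assms(2)])
  also have "\<dots> = of_bool (x \<in> f ` I)" using assms(1) by simp
  finally show ?thesis .
qed

text \<open>The exponent of \<open>Lambda a b\<close> counts in how many of \<open>L\<close> and
  \<open>R\<close> the edge lies. The values 0, 1, 2 tell whether it is in the union and in the
  intersection, but not on which side an unshared edge lies.\<close>

lemma monomial_eq_iff:
  assumes "finite S" "finite L" "finite R" "finite S'" "finite L'" "finite R'"
  shows "(\<Prod>i \<in> S. omega i) * (\<Prod>e \<in> L. lam e) * (\<Prod>e \<in> R. lam e) =
      (\<Prod>i \<in> S'. omega i) * (\<Prod>e \<in> L'. lam e) * (\<Prod>e \<in> R'. lam e)
    \<longleftrightarrow> S = S' \<and> L \<inter> R = L' \<inter> R' \<and> L \<union> R = L' \<union> R'"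
proof -
  let ?expo = "\<lambda>S L R. (\<Sum>i \<in> S. Poly_Mapping.single (Omega i) (1 :: nat)) +
    (\<Sum>e \<in> L. Poly_Mapping.single (Lambda (fst e) (snd e)) 1) +
    (\<Sum>e \<in> R. Poly_Mapping.single (Lambda (fst e) (snd e)) 1)"
  have mon: "(\<Prod>i \<in> S. omega i) * (\<Prod>e \<in> L. lam e) * (\<Prod>e \<in> R. lam e) =
      Poly_Mapping.single (?expo S L R) 1" for S :: "'a set" and L R
    by (simp add: prod_indeterminate mult_single)
  have lookups: "Poly_Mapping.lookup (?expo S L R) (Omega i) = of_bool (i \<in> S)"
      "Poly_Mapping.lookup (?expo S L R) (Lambda a b) = of_bool ((a, b) \<in> L) + of_bool ((a, b) \<in> R)"
    if "finite S" "finite L" "finite R" for S :: "'a set" and L R i a b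
  proof -
    let ?lam = "\<lambda>e. Lambda (fst e) (snd e)"
    have omega: "Poly_Mapping.lookup (\<Sum>i \<in> S. Poly_Mapping.single (Omega i) (1 :: nat)) x =
        of_bool (x \<in> Omega ` S)" for x
      by (rule lookup_sum_single[OF that(1)]) (auto intro: inj_onI)
    have lam: "Poly_Mapping.lookup (\<Sum>e \<in> M. Poly_Mapping.single (?lam e) (1 :: nat)) x =
        of_bool (x \<in> ?lam ` M)" if "finite M" for x and M :: "'a rel"
      by (rule lookup_sum_single[OF that]) (auto intro: inj_onI)
    have mem: "Lambda a b \<in> ?lam ` M \<longleftrightarrow> (a, b) \<in> M" "Omega i \<notin> ?lam ` M" for M
      by force+
    have mem': "Omega i \<in> Omega ` S \<longleftrightarrow> i \<in> S" "Lambda a b \<notin> Omega ` S"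
      by auto
    show "Poly_Mapping.lookup (?expo S L R) (Omega i) = of_bool (i \<in> S)"
      by (simp only: lookup_add omega lam that mem mem') simp
    show "Poly_Mapping.lookup (?expo S L R) (Lambda a b) = of_bool ((a, b) \<in> L) + of_bool ((a, b) \<in> R)"
      by (simp only: lookup_add omega lam that mem mem') simp
  qed
  have "?expo S L R = ?expo S' L' R' \<longleftrightarrow> S = S' \<and> L \<inter> R = L' \<inter> R' \<and> L \<union> R = L' \<union> R'"
  proof
    assume eq: "?expo S L R = ?expo S' L' R'"
    have verts: "i \<in> S \<longleftrightarrow> i \<in> S'" for i
      using arg_cong[OF eq, of "\<lambda>m. Poly_Mapping.lookup m (Omega i)"]
      unfolding lookups[OF assms(1-3)] lookups[OF assms(4-6)] of_bool_eq_iff .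
    have sums: "of_bool (e \<in> L) + of_bool (e \<in> R) = (of_bool (e \<in> L') + of_bool (e \<in> R') :: nat)" for e
      using arg_cong[OF eq, of "\<lambda>m. Poly_Mapping.lookup m (Lambda (fst e) (snd e))"]
      unfolding lookups[OF assms(1-3)] lookups[OF assms(4-6)] prod.collapse .
    have "(e \<in> L \<and> e \<in> R \<longleftrightarrow> e \<in> L' \<and> e \<in> R') \<and> (e \<in> L \<or> e \<in> R \<longleftrightarrow> e \<in> L' \<or> e \<in> R')" for e
      using sums[of e]
      by (cases "e \<in> L"; cases "e \<in> R"; cases "e \<in> L'"; cases "e \<in> R'") auto
    with verts show "S = S' \<and> L \<inter> R = L' \<inter> R' \<and> L \<union> R = L' \<union> R'" by blast
  next
    assume eq: "S = S' \<and> L \<inter> R = L' \<inter> R' \<and> L \<union> R = L' \<union> R'"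
    have edge: "of_bool (e \<in> L) + of_bool (e \<in> R) = (of_bool (e \<in> L') + of_bool (e \<in> R') :: nat)" for e
    proof -
      have "(e \<in> L \<and> e \<in> R \<longleftrightarrow> e \<in> L' \<and> e \<in> R') \<and> (e \<in> L \<or> e \<in> R \<longleftrightarrow> e \<in> L' \<or> e \<in> R')"
        using eq by blast
      then show ?thesis by auto
    qed
    show "?expo S L R = ?expo S' L' R'"
    proof (rule poly_mapping_eqI)
      fix x
      show "Poly_Mapping.lookup (?expo S L R) x = Poly_Mapping.lookup (?expo S' L' R') x"
      proof (cases x)
        case (Omega i)
        show ?thesis
          unfolding Omega lookups[OF assms(1-3)] lookups[OF assms(4-6)] using eq by simp
      next
        case (Lambda a b)
        show ?thesis
          unfolding Lambda lookups[OF assms(1-3)] lookups[OF assms(4-6)] by (rule edge)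
      qed
    qed
  qed
  moreover have "Poly_Mapping.single m (1 :: int) = Poly_Mapping.single n 1 \<longleftrightarrow> m = n"
    for m n :: "'a param \<Rightarrow>\<^sub>0 nat"
    by (metis lookup_single_eq lookup_single_not_eq zero_neq_one)
  ultimately show ?thesis by (simp only: mon)
qed

lemma trek_monomial_eq:
  assumes "pair_fin_digraph G" "self_avoiding_flow G k S A (fst T)" "self_avoiding_flow G k S B (snd T)"
  shows "trek_monomial T =
    (\<Prod>i \<in> S. omega i) * (\<Prod>e \<in> flow_edges (fst T). lam e) * (\<Prod>e \<in> flow_edges (snd T). lam e)"
proof -
  interpret pair_fin_digraph G by fact
  have mon: "flow_monomial F = (\<Prod>e \<in> flow_edges F. lam e)" if "self_avoiding_flow G k S Y F" for Y F
  proof -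
    have "finite S" using that pair_finite_verts by (auto simp: self_avoiding_flow_def intro: finite_subset)
    moreover have "finite (flow_edges F)"
      using flow_components(2)[OF assms(1) that] pair_finite_arcs by (rule finite_subset)
    ultimately show ?thesis
      using flow_monomial_linkage_flow flow_components(1)[OF assms(1) that]
        flow_eq_linkage_flow[OF assms(1) that] by metis
  qed
  have "trek_sources T = S" using assms(2) by (simp add: trek_sources_def self_avoiding_flow_def)
  then show ?thesis by (simp add: trek_monomial_def mon[OF assms(2)] mon[OF assms(3)])
qed

section \<open>Counting the trek flows with a given monomial\<close>

lemma parcs_up_down_digraph:
  assumes "pair_fin_digraph G" "self_avoiding_flow G k S A (fst T)" "self_avoiding_flow G k S B (snd T)"
  shows "parcs (up_down_digraph T) = up_down_rel S (flow_edges (fst T)) (flow_edges (snd T))"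
  using flow_components(3)[OF assms(1,2)] flow_components(3)[OF assms(1,3)]
  by (simp add: up_down_digraph_def up_down_rel_def left_arrow_def right_arrow_def unshared_edges_def)

text \<open>An up-down cycle is the vertex set of a cycle of arcs, which is the field of the arc set
  and, by circularity, its domain.\<close>

lemma up_down_cycles_eq:
  "up_down_cycles T = {Domain c |c. c \<subseteq> parcs (up_down_digraph T) \<and> circular c}"
proof -
  have wf: "pair_wf_digraph (up_down_digraph T)"
    by unfold_locales (auto simp: up_down_digraph_def)
  have "up_down_cycles T =
      cycle_verts ` {c. \<exists>q. pre_digraph.cycle (with_proj (up_down_digraph T)) q \<and> c = set q}"
    unfolding up_down_cycles_def by auto
  also have "\<dots> = Domain ` {c. c \<subseteq> parcs (up_down_digraph T) \<and> circular c}"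
    unfolding cycle_iff_circular[OF wf]
    by (intro image_cong) (auto simp: cycle_verts_eq_Field Field_circular)
  finally show ?thesis by auto
qed

lemma same_monomial_treks_bij:
  assumes G: "pair_fin_digraph G"
    and FL: "self_avoiding_flow G k S A (fst T)" and FR: "self_avoiding_flow G k S B (snd T)"
  defines "L \<equiv> flow_edges (fst T)" and "R \<equiv> flow_edges (snd T)"
  shows "bij_betw (\<lambda>U. (linkage_flow S A (sym_diff L U), linkage_flow S B (sym_diff R U)))
    {U. invariant_set (up_down_rel S L R) U}
    {T'. self_avoiding_trek_flow G k A B T' \<and> trek_monomial T' = trek_monomial T}"
    (is "bij_betw ?g ?I ?Ts")
proof -
  interpret pair_fin_digraph G by fact
  note cL = flow_components[OF G FL, folded L_def] and cR = flow_components[OF G FR, folded R_def]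
  have k: "S \<subseteq> pverts G" "card S = k" "A \<subseteq> pverts G" "card A = k" "B \<subseteq> pverts G" "card B = k"
    using FL FR by (auto simp: self_avoiding_flow_def)
  have finS: "finite S" using k(1) pair_finite_verts by (rule finite_subset)
  have fin: "finite M" if "M \<subseteq> parcs G" for M using that pair_finite_arcs by (rule finite_subset)
  have I: "U \<in> ?I \<longleftrightarrow> U \<subseteq> sym_diff L R \<and> linkage S A (sym_diff L U) \<and> linkage S B (sym_diff R U)" for U
    using invariant_set_up_down_rel_iff_linkage[OF cL(1) cR(1)] by simp
  have sub: "sym_diff L U \<subseteq> parcs G" "sym_diff R U \<subseteq> parcs G" if "U \<in> ?I" for U
    using that cL(2) cR(2) unfolding I by blast+
  have edges: "flow_edges (linkage_flow S A (sym_diff L U)) = sym_diff L U"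
      "flow_edges (linkage_flow S B (sym_diff R U)) = sym_diff R U" if "U \<in> ?I" for U
    using flow_edges_linkage_flow fin[OF sub(1)[OF that]] fin[OF sub(2)[OF that]] that unfolding I
    by blast+
  have mon: "trek_monomial T' = trek_monomial T \<longleftrightarrow>
      S' = S \<and> flow_edges (fst T') \<inter> flow_edges (snd T') = L \<inter> R \<and>
      flow_edges (fst T') \<union> flow_edges (snd T') = L \<union> R"
    if T': "self_avoiding_flow G k S' A (fst T')" "self_avoiding_flow G k S' B (snd T')" for S' T'
  proof -
    have "finite S'" using T'(1) pair_finite_verts
      by (auto simp: self_avoiding_flow_def intro: finite_subset)
    from monomial_eq_iff[OF this fin[OF flow_components(2)[OF G T'(1)]]
        fin[OF flow_components(2)[OF G T'(2)]] finS fin[OF cL(2)] fin[OF cR(2)]]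
    show ?thesis
      unfolding trek_monomial_eq[OF G T'] trek_monomial_eq[OF G FL FR, folded L_def R_def] .
  qed
  show ?thesis
  proof (rule bij_betw_imageI)
    show "inj_on ?g ?I"
    proof (rule inj_onI)
      fix U V assume UV: "U \<in> ?I" "V \<in> ?I" "?g U = ?g V"
      from UV(3) have "flow_edges (linkage_flow S A (sym_diff L U)) =
          flow_edges (linkage_flow S A (sym_diff L V))"
        by (simp only: prod.inject)
      then have "sym_diff L U = sym_diff L V"
        by (simp only: edges(1)[OF UV(1)] edges(1)[OF UV(2)])
      then have "x \<in> sym_diff L U \<longleftrightarrow> x \<in> sym_diff L V" for x by (simp only:)
      then show "U = V" by blast
    qed
    show "?g ` ?I = ?Ts"
    proof (intro equalityI subsetI)
      fix T' assume "T' \<in> ?g ` ?I"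
      then obtain U where U: "U \<in> ?I" and T': "T' = ?g U" by blast
      have flows: "self_avoiding_flow G k S A (fst T')" "self_avoiding_flow G k S B (snd T')"
        using U T' linkage_flow_is_flow[OF G _ sub(1)[OF U]] linkage_flow_is_flow[OF G _ sub(2)[OF U]] k
        unfolding I by auto
      have "U \<subseteq> sym_diff L R" using U unfolding I by blast
      then have "sym_diff L U \<inter> sym_diff R U = L \<inter> R" "sym_diff L U \<union> sym_diff R U = L \<union> R"
        by blast+
      then have "trek_monomial T' = trek_monomial T"
        unfolding mon[OF flows] using edges[OF U] by (simp add: T')
      with flows show "T' \<in> ?Ts" by (auto simp: self_avoiding_trek_flow_def)
    next
      fix T' assume "T' \<in> ?Ts"
      then obtain S' where flows': "self_avoiding_flow G k S' A (fst T')" "self_avoiding_flow G k S' B (snd T')"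
        and eq: "trek_monomial T' = trek_monomial T"
        by (auto simp: self_avoiding_trek_flow_def)
      define L' where "L' = flow_edges (fst T')"
      define R' where "R' = flow_edges (snd T')"
      \<comment> \<open>The monomial fixes the sources, so a trek flow with equal monomial starts
        from the same \<open>S\<close>.\<close>
      have "S' = S" and LR: "L' \<inter> R' = L \<inter> R" "L' \<union> R' = L \<union> R"
        using eq unfolding mon[OF flows'] L'_def R'_def by auto
      note flows = flows'[unfolded \<open>S' = S\<close>]
      \<comment> \<open>The exchanged edges are those on which the left flows differ. As union and
        intersection are preserved, the same \<open>U\<close> turns \<open>R\<close> into
        \<open>R'\<close>.\<close>
      define U where "U = sym_diff L L'"
      have U: "U \<subseteq> sym_diff L R" "sym_diff L U = L'" "sym_diff R U = R'"
        unfolding U_def using LR by blast+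
      have "linkage S A L'" "linkage S B R'"
        using flow_components(1)[OF G flows(1)] flow_components(1)[OF G flows(2)]
        by (auto simp: L'_def R'_def)
      with U have "U \<in> ?I" unfolding I by simp
      moreover have "T' = ?g U"
        using flow_eq_linkage_flow[OF G flows(1)] flow_eq_linkage_flow[OF G flows(2)] U(2,3)
        by (simp add: L'_def R'_def prod_eq_iff)
      ultimately show "T' \<in> ?g ` ?I" by blast
    qed
  qed
qed

theorem theorem3p11:
  fixes G :: "'v pair_pre_digraph"
    and A B :: "'v set"
    and ordA ordB :: "'v rel"
    and k :: nat
    and T :: "'v trek_flow"
  assumes "pair_digraph G"
    and "A \<subseteq> pverts G" and "card A = k" and "linear_order_on A ordA"
    and "B \<subseteq> pverts G" and "card B = k" and "linear_order_on B ordB"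
    and "self_avoiding_trek_flow G k A B T"
  shows "card {T'. self_avoiding_trek_flow G k A B T' \<and> trek_monomial T' = trek_monomial T}
           = 2 ^ card (up_down_cycles T)"
proof -
  interpret pair_digraph G by fact
  have G: "pair_fin_digraph G" by unfold_locales
  obtain S where S: "self_avoiding_flow G k S A (fst T)" "self_avoiding_flow G k S B (snd T)"
    using assms(8) by (auto simp: self_avoiding_trek_flow_def)
  let ?L = "flow_edges (fst T)" and ?R = "flow_edges (snd T)"
  let ?\<Gamma> = "up_down_rel S ?L ?R"
  note cL = flow_components[OF G S(1)] and cR = flow_components[OF G S(2)]
  have "?\<Gamma> \<subseteq> parcs G \<times> parcs G" using cL(2) cR(2) by (auto simp: up_down_rel_def)
  then have "finite ?\<Gamma>" using pair_finite_arcs by (auto intro: finite_subset)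
  with partial_injection_up_down_rel[OF cL(1) cR(1)]
  have "card {U. invariant_set ?\<Gamma> U} = 2 ^ card {Domain c |c. c \<subseteq> ?\<Gamma> \<and> circular c}"
    by (rule card_invariant_sets)
  then show ?thesis
    using bij_betw_same_card[OF same_monomial_treks_bij[OF G S]]
    by (simp only: up_down_cycles_eq parcs_up_down_digraph[OF G S])
qed

end
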